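(* For every $q\in[2,\infty)$, there exists $\gamma=\gamma(q)\in(0,\infty)$, depending only on $q$, such that the following holds. Let $(X,|\cdot|)$ be a Banach space and $\tilde\delta>0$ be such that $$|x+h|^q \geq |x|^q + \phi'(x)h + \tilde\delta |h|^q \quad\text{for every } x,h\in X,$$ where $\phi(x)=|x|^q$ and $\phi'(x)h$ is its one-sided directional derivative. Let $(f_n)_{n\in\mathbb{N}}$ be a martingale on a filtered probability space $(\Omega,(\mathcal{F}_n)_{n\in\mathbb{N}})$ with values in $X$, and $(w_n)_{n\in\mathbb{N}}$ an adapted sequence of weights. Then $$\mathbb{E}\Bigl( \gamma |f_0| w_0 + \tilde\delta \sum_{n=1}^{\infty} \frac{|df_n|^q}{(f^*_n)^{q-1}} w_n \Bigr) \leq \gamma\, \mathbb{E}( f^* w^* ).$$ In the case $q=2$, we can take $\gamma=4$. In the case $q=2$, $\tilde\delta=1$, and $w_n=1$ for all $n\in\mathbb{N}$, we can take $\gamma=3$.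
   Context: Here $\mathbb{N}=\{0,1,2,\dots\}$. For a Banach space $(X,|\cdot|)$ and $\phi:X\to[0,\infty)$, $\phi(x)=|x|^q$, the directional derivative at $x$ in direction $h$ is $\phi'(x)h := \lim_{t\to 0,\, t>0} \frac{\phi(x+th)-\phi(x)}{t}$ (this limit exists because $\phi$ is convex). A weight is a positive random variable on $\Omega$; adapted means that $w_n$ is $\mathcal{F}_n$-measurable for every $n$. Notation: $df_n = f_n-f_{n-1}$ (for $n\geq 1$), $f^*_n := \max_{n'\leq n}|f_{n'}|$, $w^*_n := \max_{n'\leq n} w_{n'}$, $f^* = f^*_\infty = \sup_{n\in\mathbb{N}} |f_n|$, $w^* = w^*_\infty=\sup_{n\in\mathbb{N}} w_n$. Expectations of nonnegative random variables take values in $[0,\infty]$. The quotient $|df_n|^q/(f^*_n)^{q-1}$ is interpreted as $0$ where $f^*_n=0$ (in which case also $df_n=0$). *)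

theory Defs
  imports "HOL-Probability.Probability"
begin

definition directional_deriv :: "('x::real_normed_vector \<Rightarrow> real) \<Rightarrow> 'x \<Rightarrow> 'x \<Rightarrow> real" where
  "directional_deriv \<phi> x h = Lim (at_right 0) (\<lambda>t. (\<phi> (x + t *\<^sub>R h) - \<phi> x) / t)"

text \<open>
  The library's Bochner integral is restricted to second countable (that is, separable) spaces.
  The Banach spaces here are arbitrary, so the notion is restated without that restriction:
  measurability is strong measurability (pointwise limits of simple functions), and the integral is
  the limit of the library's integrals of simple functions, as in \<^const>\<open>has_bochner_integral\<close>.
\<close>

definition strongly_measurable :: "'w measure \<Rightarrow> ('w \<Rightarrow> 'x::real_normed_vector) \<Rightarrow> bool" where
  "strongly_measurable M f \<longleftrightarrow>
     (\<exists>s. (\<forall>i::nat. simple_function M (s i)) \<and>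
          (\<forall>\<omega>\<in>space M. (\<lambda>i. s i \<omega>) \<longlonglongrightarrow> f \<omega>))"

definition has_strong_bochner_integral ::
    "'w measure \<Rightarrow> ('w \<Rightarrow> 'x::real_normed_vector) \<Rightarrow> 'x \<Rightarrow> bool" where
  "has_strong_bochner_integral M f v \<longleftrightarrow>
     strongly_measurable M f \<and>
     (\<exists>s. (\<forall>i::nat. Bochner_Integration.simple_bochner_integrable M (s i)) \<and>
          (\<lambda>i. \<integral>\<^sup>+\<omega>. ennreal (norm (f \<omega> - s i \<omega>)) \<partial>M) \<longlonglongrightarrow> 0 \<and>
          (\<lambda>i. Bochner_Integration.simple_bochner_integral M (s i)) \<longlonglongrightarrow> v)"

text \<open>
  \<open>g\<close> is a version of the conditional expectation of \<open>f\<close> given the \<open>\<sigma>\<close>-algebra of \<open>G\<close>.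
  Integrability of \<open>f\<close> and \<open>g\<close> is the instance \<open>A = space G\<close>.
\<close>

definition is_cond_expectation ::
    "'w measure \<Rightarrow> 'w measure \<Rightarrow> ('w \<Rightarrow> 'x::real_normed_vector) \<Rightarrow> ('w \<Rightarrow> 'x) \<Rightarrow> bool" where
  "is_cond_expectation M G f g \<longleftrightarrow>
     strongly_measurable G g \<and>
     (\<forall>A\<in>sets G. \<exists>v. has_strong_bochner_integral M (\<lambda>\<omega>. indicator A \<omega> *\<^sub>R f \<omega>) v \<and>
                     has_strong_bochner_integral M (\<lambda>\<omega>. indicator A \<omega> *\<^sub>R g \<omega>) v)"

definition filtered_prob_space :: "'w measure \<Rightarrow> (nat \<Rightarrow> 'w measure) \<Rightarrow> bool" where
  "filtered_prob_space M F \<longleftrightarrow>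
     prob_space M \<and> filtration (space M) F \<and> (\<forall>n. subalgebra M (F n))"

text \<open>Adaptedness and integrability are the instance \<open>m = n\<close>.\<close>

definition banach_martingale ::
    "'w measure \<Rightarrow> (nat \<Rightarrow> 'w measure) \<Rightarrow> (nat \<Rightarrow> 'w \<Rightarrow> 'x::banach) \<Rightarrow> bool" where
  "banach_martingale M F f \<longleftrightarrow> (\<forall>m n. m \<le> n \<longrightarrow> is_cond_expectation M (F m) (f n) (f m))"

definition adapted_weights ::
    "'w measure \<Rightarrow> (nat \<Rightarrow> 'w measure) \<Rightarrow> (nat \<Rightarrow> 'w \<Rightarrow> real) \<Rightarrow> bool" where
  "adapted_weights M F w \<longleftrightarrow>
     (\<forall>n. w n \<in> borel_measurable (F n) \<and> (\<forall>\<omega>\<in>space M. 0 < w n \<omega>))"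

definition running_max :: "(nat \<Rightarrow> 'w \<Rightarrow> 'x::real_normed_vector) \<Rightarrow> nat \<Rightarrow> 'w \<Rightarrow> real" where
  "running_max f n \<omega> = Max ((\<lambda>k. norm (f k \<omega>)) ` {..n})"

text \<open>
  The weighted inequality with constant \<open>\<gamma>\<close>, in \<open>[0,\<infinity>]\<close>.  The summand of index \<open>n\<close> is the term
  of index \<open>n + 1\<close> of the series; it vanishes when the running maximum does, since \<open>x / 0 = 0\<close>.
  On the right \<open>0 * \<infinity> = 0\<close>, relevant where \<open>f\<^sup>* = 0\<close> and \<open>w\<^sup>* = \<infinity>\<close>.
\<close>

definition weighted_inequality ::
    "'w measure \<Rightarrow> (nat \<Rightarrow> 'w \<Rightarrow> 'x::real_normed_vector) \<Rightarrow> (nat \<Rightarrow> 'w \<Rightarrow> real) \<Rightarrow>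
     real \<Rightarrow> real \<Rightarrow> real \<Rightarrow> bool" where
  "weighted_inequality M f w q \<delta> \<gamma> \<longleftrightarrow>
     (\<integral>\<^sup>+\<omega>. ennreal (\<gamma> * norm (f 0 \<omega>) * w 0 \<omega>) +
            ennreal \<delta> * (\<Sum>n. ennreal (norm (f (Suc n) \<omega> - f n \<omega>) powr q
                                     / running_max f (Suc n) \<omega> powr (q - 1) * w (Suc n) \<omega>)) \<partial>M)
     \<le> ennreal \<gamma> *
        (\<integral>\<^sup>+\<omega>. (SUP n. ennreal (norm (f n \<omega>))) * (SUP n. ennreal (w n \<omega>)) \<partial>M)"

text \<open>
  HOL cannot quantify over types inside a formula, so a constant \<open>\<gamma>\<close> that is existentially
  quantified in a theorem could depend on the types of the Banach space and of the sample space.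
  That \<open>\<gamma>\<close> depends on \<open>q\<close> only is therefore expressed by an explicit witness,
  a constant of type \<^typ>\<open>real \<Rightarrow> real\<close>.  The value \<open>2 q = 1 + (2 q - 1)\<close> comes from telescoping
  \<open>w\<^sup>*\<^sub>n |f\<^sub>n|\<^sup>q / (f\<^sup>*\<^sub>n)\<^sup>q\<^sup>-\<^sup>1 + (2 q - 1) w\<^sup>*\<^sub>n f\<^sup>*\<^sub>n\<close>; it is \<open>4\<close> at \<open>q = 2\<close>.
\<close>

definition gamma_of :: "real \<Rightarrow> real" where
  "gamma_of q = 2 * q"

end

theory Submission
  imports Defs
begin

text \<open>
  Let \<open>s\<^sub>n = f\<^sup>*\<^sub>n\<close>, \<open>W\<^sub>n = w\<^sup>*\<^sub>n\<close> and \<open>V\<^sub>n = W\<^sub>n (|f\<^sub>n|\<^sup>q / s\<^sub>n\<^sup>q\<^sup>-\<^sup>1 + C s\<^sub>n)\<close>, so that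
  \<open>V\<^sub>n \<le> (1 + C) W\<^sub>n s\<^sub>n\<close>, with equality for \<open>n = 0\<close>.  Let \<open>N'(x)h\<close> be the directional derivative
  of the norm and \<open>Z\<^sub>n = q W\<^sub>n |f\<^sub>n|\<^sup>q\<^sup>-\<^sup>1 / s\<^sub>n\<^sup>q\<^sup>-\<^sup>1\<close>.  From \<open>n\<close> to \<open>n + 1\<close> the function \<open>V\<close> grows by at
  least the new term of the square function plus \<open>Z\<^sub>n N'(f\<^sub>n) df\<^sub>n\<^sub>+\<^sub>1\<close>.  The latter has nonnegative
  expectation by Jensen's inequality, since \<open>Z\<^sub>n\<close> is known at time \<open>n\<close>; summation gives the theorem with
  \<open>\<gamma> = 1 + C\<close>.  If neither maximum jumps, the growth of \<open>V\<close> is the convexity hypothesis.  A jump of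
  \<open>s\<close> is paid for by \<open>C \<ge> 2 q - 2\<close>, a jump of \<open>W\<close> by \<open>C \<ge> 2 q - 1\<close>; constant weights do not jump,
  hence the better constant \<open>3\<close>.
\<close>

section \<open>The pointwise inequality\<close>

text \<open>Young's inequality with weights \<open>1/p\<close> and \<open>1 - 1/p\<close>, applied
  to \<open>r powr p\<close> and \<open>1\<close>, is this bound divided by
  \<open>p\<close>.\<close>

lemma powr_ge_tangent_at_1:
  fixes r p :: real
  assumes "0 \<le> r" and "1 \<le> p"
  shows "1 + p * (r - 1) \<le> r powr p"
proof (cases "r = 0")
  case True
  show ?thesis
    using assms(2) unfolding True by (simp add: right_diff_distrib)
next
  case False
  have "(r powr p) powr (1/p) * 1 powr (1 - 1/p) \<le> 1/p * r powr p + (1 - 1/p) * 1"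
    using assms False by (intro Youngs_inequality_0) auto
  then have "p * r \<le> p * (1/p * r powr p + (1 - 1/p) * 1)"
    using assms False by (intro mult_left_mono) (auto simp: powr_powr)
  then show ?thesis
    using assms by (simp add: algebra_simps)
qed

text \<open>The expression on the left is the value at \<open>b\<close> of the tangent to
  \<open>x powr q\<close> at \<open>a\<close>. Its derivative in \<open>a\<close> is
  \<open>q * (q - 1) * a powr (q - 2) * (b - a)\<close>, so it increases up to \<open>a = b\<close>.
  The proof avoids calculus: it applies the tangent inequality at \<open>1\<close> to the ratio of
  \<open>s\<close> and \<open>a\<close>.\<close>

lemma powr_tangent_le:
  fixes a s b q :: real
  assumes "0 \<le> a" and "a \<le> s" and "0 < s" and "s \<le> b" and q: "2 \<le> q"
  shows "a powr (q - 1) * (q * b - (q - 1) * a) \<le> s powr (q - 1) * (q * b - (q - 1) * s)"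
proof (cases "a = 0")
  case True
  have "(q - 1) * s \<le> q * b"
    using assms by (intro mult_mono) auto
  with True show ?thesis by simp
next
  case False
  define p \<rho> where "p = q - 1" and "\<rho> = a / s"
  have \<rho>: "0 < \<rho>" "\<rho> \<le> 1" and p: "1 \<le> p" and a: "a = \<rho> * s"
    using False assms by (auto simp: \<rho>_def p_def)
  have pow1: "\<rho> powr p \<le> 1"
    using \<rho> p by (intro powr_le1) auto
  \<comment> \<open>The comparison \<open>1 - \<rho> \<le> 1 / \<rho> - 1\<close> brings
    \<open>1 + p * (1 - \<rho>)\<close> below the tangent bound for
    \<open>(1 / \<rho>) powr p\<close>.\<close>
  have "(1 / \<rho> - 1) - (1 - \<rho>) = (1 - \<rho>)\<^sup>2 / \<rho>"
    using \<rho> by (simp add: field_simps power2_eq_square)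
  moreover have "0 \<le> (1 - \<rho>)\<^sup>2 / \<rho>"
    using \<rho> by simp
  ultimately have "p * (1 - \<rho>) \<le> p * (1 / \<rho> - 1)"
    using p by (intro mult_left_mono) linarith+
  moreover have "1 + p * (1 / \<rho> - 1) \<le> (1 / \<rho>) powr p"
    using \<rho> p by (intro powr_ge_tangent_at_1) auto
  ultimately have "1 + p * (1 - \<rho>) \<le> (1 / \<rho>) powr p"
    by linarith
  then have "\<rho> powr p * (1 + p * (1 - \<rho>)) \<le> \<rho> powr p * (1 / \<rho>) powr p"
    by (intro mult_left_mono) auto
  then have one: "\<rho> powr p * (1 + p * (1 - \<rho>)) \<le> 1"
    using \<rho> by (simp add: powr_divide)
  \<comment> \<open>Since \<open>q = p + 1\<close>, the bracket splits at \<open>s\<close>: the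
    excess \<open>b - s\<close> only needs \<open>\<rho> powr p \<le> 1\<close>, and the rest is the
    case \<open>b = s\<close>, which is \<open>one\<close>.\<close>
  have "\<rho> powr p * (q * b - p * a) = \<rho> powr p * (q * (b - s)) + (\<rho> powr p * (1 + p * (1 - \<rho>))) * s"
    by (simp add: a p_def algebra_simps)
  also have "\<dots> \<le> 1 * (q * (b - s)) + 1 * s"
    using pow1 one assms by (intro add_mono mult_right_mono) auto
  finally have "s powr p * (\<rho> powr p * (q * b - p * a)) \<le> s powr p * (q * b - p * s)"
    by (intro mult_left_mono) (auto simp: p_def algebra_simps)
  moreover have "a powr p = s powr p * \<rho> powr p"
    using \<rho> assms(3) by (simp add: a powr_mult)
  ultimately show ?thesis
    by (simp add: p_def mult.assoc)
qed

text \<open>The cost of an increase of the running maximum from \<open>s\<close> to \<open>b\<close>.\<close>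

lemma running_max_jump:
  fixes s b q :: real
  assumes "0 < s" and "s \<le> b" and q: "2 \<le> q"
  shows "(q * b - (q - 1) * s) * (1 - s powr (q - 1) / b powr (q - 1)) \<le> (2 * q - 2) * (b - s)"
proof -
  define p v where "p = q - 1" and "v = 1 - (s / b) powr p"
  have p: "1 \<le> p" and b: "0 < b" using assms by (auto simp: p_def)
  have v1: "v \<le> 1" by (simp add: v_def)
  have "v \<le> p * (1 - s / b)"
    using powr_ge_tangent_at_1[of "s / b" p] p assms by (simp add: v_def algebra_simps)
  then have "v * b \<le> p * (1 - s / b) * b"
    using b by (intro mult_right_mono) auto
  also have "\<dots> = p * (b - s)"
    using b by (simp add: field_simps)
  \<comment> \<open>The factor \<open>q * b - p * s\<close> is \<open>b + p * (b - s)\<close>. The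
    linear bound on \<open>v\<close> serves the first summand and \<open>v \<le> 1\<close> the
    second; each costs \<open>p * (b - s)\<close>, which explains \<open>2 * q - 2\<close>.\<close>
  finally have "v * b + v * (p * (b - s)) \<le> p * (b - s) + 1 * (p * (b - s))"
    using v1 p assms by (intro add_mono mult_right_mono) auto
  moreover have "v = 1 - s powr p / b powr p"
    using assms by (simp add: v_def powr_divide)
  moreover have "(q * b - (q - 1) * s) * v = v * b + v * (p * (b - s))"
    by (simp add: p_def algebra_simps)
  ultimately have "(q * b - (q - 1) * s) * (1 - s powr p / b powr p) \<le> p * (b - s) + p * (b - s)"
    by simp
  then show ?thesis
    by (simp add: p_def left_diff_distrib)
qed

text \<open>In the application \<open>a\<close> and \<open>b\<close> are the norms of the old and
  the new value, \<open>k\<close> is the norm of the increment, \<open>s\<close> is the old running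
  maximum and \<open>D\<close> is the derivative of the norm along the increment. If
  \<open>b \<le> s\<close>, the claim is \<open>conv\<close> divided by
  \<open>s powr (q - 1)\<close>. If the maximum rises to \<open>b\<close>, the denominator changes,
  and the growth \<open>C * (b - s)\<close> compensates for that.\<close>

lemma bellman_step_unweighted:
  fixes a b k s q \<delta> C D :: real
  assumes q: "2 \<le> q" and nn: "0 \<le> \<delta>" "0 \<le> a" "0 \<le> b" and "a \<le> s"
    and C: "2 * q - 2 \<le> C" and D: "D \<le> b - a"
    and conv: "a powr q + q * a powr (q - 1) * D + \<delta> * k powr q \<le> b powr q"
  shows "a powr q / s powr (q - 1) + C * s + q * a powr (q - 1) / s powr (q - 1) * D
           + \<delta> * k powr q / max s b powr (q - 1)
         \<le> b powr q / max s b powr (q - 1) + C * max s b"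
proof -
  have C0: "0 \<le> C" using q C by simp
  define E where "E = a powr q + q * a powr (q - 1) * D"
  have conv': "\<delta> * k powr q \<le> b powr q - E"
    using conv by (simp add: E_def)
  \<comment> \<open>\<open>s = 0\<close> forces \<open>a = 0\<close>, and all quotients by
    \<open>s powr (q - 1)\<close> are then \<open>0\<close>.\<close>
  consider "s = 0" | "0 < s" "b \<le> s" | "0 < s" "s < b"
    using assms by linarith
  then show ?thesis
  proof cases
    case 1
    then have "a = 0" using assms by simp
    then have "\<delta> * k powr q / max s b powr (q - 1) \<le> b powr q / max s b powr (q - 1)"
      using conv by (intro divide_right_mono) auto
    moreover have "0 \<le> C * b" using C0 nn by simp
    ultimately show ?thesis using 1 \<open>a = 0\<close> nn by (simp add: max_def)
  next
    case 2
    have "(E + \<delta> * k powr q) / s powr (q - 1) \<le> b powr q / s powr (q - 1)"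
      using conv' by (intro divide_right_mono) auto
    then show ?thesis
      using 2 by (simp add: max_def E_def add_divide_distrib)
  next
    case 3
    define P P' where "P = s powr (q - 1)" and "P' = b powr (q - 1)"
    have P: "0 < P" "P \<le> P'" "0 < P'"
      using 3 q by (auto simp: P_def P'_def intro!: powr_mono2)
    have aq: "a powr q = a powr (q - 1) * a"
      using nn q by (cases "a = 0") (auto simp: powr_diff)
    \<comment> \<open>By \<open>D \<le> b - a\<close>, \<open>E\<close> is at most the tangent value
      at \<open>b\<close> of the power \<open>q\<close>; among the tangent points up to
      \<open>s\<close> the worst one is \<open>s\<close> itself.\<close>
    have "q * a powr (q - 1) * D \<le> q * a powr (q - 1) * (b - a)"
      using D q by (intro mult_left_mono) auto
    then have "E \<le> a powr (q - 1) * (q * b - (q - 1) * a)"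
      unfolding E_def aq by (simp add: algebra_simps)
    also have "\<dots> \<le> P * (q * b - (q - 1) * s)"
      unfolding P_def using assms 3 by (intro powr_tangent_le) auto
    \<comment> \<open>The left side is the cost of changing the denominator of \<open>E\<close> from
      \<open>P\<close> to \<open>P'\<close>.\<close>
    finally have "E * (1 / P - 1 / P') \<le> P * (q * b - (q - 1) * s) * (1 / P - 1 / P')"
      using P by (intro mult_right_mono) (auto simp: field_simps)
    also have "\<dots> = (q * b - (q - 1) * s) * (1 - P / P')"
      using P by (simp add: field_simps)
    also have "\<dots> \<le> (2 * q - 2) * (b - s)"
      unfolding P_def P'_def using 3 q by (intro running_max_jump) auto
    also have "\<dots> \<le> C * (b - s)"
      using C 3 by (intro mult_right_mono) auto
    finally have "E / P - E / P' \<le> C * b - C * s"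
      by (simp add: algebra_simps)
    moreover have "\<delta> * k powr q / P' \<le> b powr q / P' - E / P'"
      using divide_right_mono[OF conv', of P'] P by (simp add: diff_divide_distrib)
    moreover have "E / P = a powr q / P + q * a powr (q - 1) / P * D"
      by (simp add: E_def add_divide_distrib)
    ultimately show ?thesis
      using 3 by (simp add: P_def P'_def max_def)
  qed
qed

text \<open>This serves the part of the weight that appears only at the new time, to which no
  earlier value of the Bellman function belongs; \<open>s\<close> is the new maximum. Inserting
  \<open>D \<ge> - (a + b)\<close> into \<open>conv\<close> leaves
  \<open>b powr q + a powr (q - 1) * ((q - 1) * a + q * b)\<close>, whence
  \<open>2 * q - 1\<close>.\<close>

lemma increment_le_running_max:
  fixes a b k s q \<delta> C D :: real
  assumes q: "2 \<le> q" and nn: "0 \<le> a" "0 \<le> b" and s: "a \<le> s" "b \<le> s" and k: "k \<le> a + b"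
    and C: "2 * q - 1 \<le> C" and D: "- k \<le> D"
    and conv: "a powr q + q * a powr (q - 1) * D + \<delta> * k powr q \<le> b powr q"
  shows "\<delta> * k powr q / s powr (q - 1) \<le> b powr q / s powr (q - 1) + C * s"
proof (cases "s = 0")
  case False
  then have s0: "0 < s" using nn s by simp
  define P where "P = s powr (q - 1)"
  have P: "0 < P" using s0 by (simp add: P_def)
  have aq: "a powr q = a powr (q - 1) * a"
    using nn q by (cases "a = 0") (auto simp: powr_diff)
  have "q * a powr (q - 1) * - (a + b) \<le> q * a powr (q - 1) * D"
    using D k q by (intro mult_left_mono) auto
  then have "\<delta> * k powr q \<le> b powr q + a powr (q - 1) * ((q - 1) * a + q * b)"
    using conv unfolding aq by (simp add: algebra_simps)
  also have "a powr (q - 1) * ((q - 1) * a + q * b) \<le> P * ((q - 1) * s + q * s)"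
    unfolding P_def using assms by (intro mult_mono add_mono powr_mono2) auto
  also have "(q - 1) * s + q * s \<le> C * s"
    using mult_right_mono[OF C, of s] s0 by (simp add: algebra_simps)
  finally have "\<delta> * k powr q \<le> b powr q + P * (C * s)"
    using P by simp
  from divide_right_mono[OF this, of P] P show ?thesis
    by (simp add: P_def add_divide_distrib)
qed simp

text \<open>The new maximal weight is split as \<open>W + (W' - W)\<close>. The share
  \<open>W\<close> is handled by \<open>bellman_step_unweighted\<close>, the share
  \<open>W' - W\<close> by \<open>increment_le_running_max\<close> unless it is zero. The current
  weight \<open>v\<close> is replaced by its upper bound \<open>W'\<close>.\<close>

lemma bellman_step:
  fixes a b k s q \<delta> C D v W W' :: real
  assumes q: "2 \<le> q" and nn: "0 \<le> \<delta>" "0 \<le> a" "0 \<le> b" and s: "a \<le> s" and k: "k \<le> a + b"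
    and C: "2 * q - 2 \<le> C" "W' = W \<or> 2 * q - 1 \<le> C"
    and W: "0 \<le> W" "W \<le> W'" "v \<le> W'"
    and D: "- k \<le> D" "D \<le> b - a"
    and conv: "a powr q + q * a powr (q - 1) * D + \<delta> * k powr q \<le> b powr q"
  shows "W * (a powr q / s powr (q - 1) + C * s) + W * (q * a powr (q - 1) / s powr (q - 1)) * D
           + \<delta> * (k powr q / max s b powr (q - 1) * v)
         \<le> W' * (b powr q / max s b powr (q - 1) + C * max s b)"
proof -
  define T V' where "T = \<delta> * k powr q / max s b powr (q - 1)"
    and "V' = b powr q / max s b powr (q - 1) + C * max s b"
  have 1: "W * (a powr q / s powr (q - 1) + C * s + q * a powr (q - 1) / s powr (q - 1) * D + T) \<le> W * V'"
    unfolding T_def V'_def using assms by (intro mult_left_mono bellman_step_unweighted) auto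
  have 2: "(W' - W) * T \<le> (W' - W) * V'"
  proof (cases "W' = W")
    case False
    then have "2 * q - 1 \<le> C" using C by simp
    then show ?thesis
      unfolding T_def V'_def using assms
      by (intro mult_left_mono increment_le_running_max[where a = a and D = D]) auto
  qed simp
  have "T * v \<le> T * W'"
    using W nn by (intro mult_left_mono) (auto simp: T_def)
  moreover have "\<delta> * (k powr q / max s b powr (q - 1) * v) = T * v"
    by (simp add: T_def)
  ultimately show ?thesis
    using 1 2 unfolding V'_def[symmetric] by (simp add: algebra_simps)
qed

section \<open>Directional derivatives of the norm\<close>

text \<open>Convexity of the norm along a ray: \<open>x + t *\<^sub>R h\<close> is a convex
  combination of \<open>x\<close> and \<open>x + u *\<^sub>R h\<close>.\<close>

lemma norm_quotient_mono:
  fixes x h :: "'x::real_normed_vector"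
  assumes "0 < t" and "t \<le> u"
  shows "(norm (x + t *\<^sub>R h) - norm x) / t \<le> (norm (x + u *\<^sub>R h) - norm x) / u"
proof -
  have "u *\<^sub>R (x + t *\<^sub>R h) = (u - t) *\<^sub>R x + t *\<^sub>R (x + u *\<^sub>R h)"
    by (simp add: algebra_simps)
  then have "norm (u *\<^sub>R (x + t *\<^sub>R h)) \<le> norm ((u - t) *\<^sub>R x) + norm (t *\<^sub>R (x + u *\<^sub>R h))"
    by (metis norm_triangle_ineq)
  then have "u * norm (x + t *\<^sub>R h) \<le> (u - t) * norm x + t * norm (x + u *\<^sub>R h)"
    using assms by simp
  then show ?thesis
    using assms by (simp add: field_simps)
qed

lemma norm_quotient_bound:
  fixes x h :: "'x::real_normed_vector"
  assumes "0 < t"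
  shows "\<bar>(norm (x + t *\<^sub>R h) - norm x) / t\<bar> \<le> norm h"
  using norm_triangle_ineq3[of "x + t *\<^sub>R h" x] assms by (simp add: field_simps)

text \<open>\<open>Lim\<close> is meaningful only once the limit exists. The quotients decrease as
  \<open>t\<close> decreases to \<open>0\<close> and stay above \<open>- norm h\<close>, so they
  tend to their infimum.\<close>

lemma tendsto_directional_deriv_norm:
  fixes x h :: "'x::real_normed_vector"
  shows "((\<lambda>t. (norm (x + t *\<^sub>R h) - norm x) / t) \<longlongrightarrow> directional_deriv norm x h) (at_right 0)"
proof -
  define g where "g t = (norm (x + t *\<^sub>R h) - norm x) / t" for t
  define l where "l = Inf (g ` {0<..})"
  have bdd: "bdd_below (g ` {0<..})"
    using norm_quotient_bound[of _ x h] unfolding abs_le_iff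
    by (intro bdd_belowI[of _ "- norm h"]) (fastforce simp: g_def)
  have "(g \<longlongrightarrow> l) (at_right 0)"
  proof (rule order_tendstoI)
    fix y assume "y < l"
    moreover have "\<forall>\<^sub>F t in at_right 0. l \<le> g t"
      unfolding l_def by (rule eventually_at_rightI[of 0 1]) (auto intro!: cInf_lower bdd)
    ultimately show "\<forall>\<^sub>F t in at_right 0. y < g t"
      by (auto elim: eventually_mono)
  next
    fix y assume "l < y"
    then obtain u where u: "0 < u" "g u < y"
      unfolding l_def by (subst (asm) cInf_less_iff) (auto simp: bdd)
    show "\<forall>\<^sub>F t in at_right 0. g t < y"
    proof (rule eventually_at_rightI[OF _ u(1)])
      fix t assume "t \<in> {0<..<u}"
      then have "g t \<le> g u"
        unfolding g_def by (intro norm_quotient_mono) auto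
      with u(2) show "g t < y" by simp
    qed
  qed
  then show ?thesis
    unfolding directional_deriv_def g_def
    by (simp add: tendsto_Lim)
qed

lemma directional_deriv_norm_bounds:
  fixes x h :: "'x::real_normed_vector"
  shows "\<bar>directional_deriv norm x h\<bar> \<le> norm h" (is ?A)
    and "directional_deriv norm x h \<le> norm (x + h) - norm x" (is ?B)
proof -
  have lim: "((\<lambda>t. \<bar>(norm (x + t *\<^sub>R h) - norm x) / t\<bar>) \<longlongrightarrow> \<bar>directional_deriv norm x h\<bar>) (at_right 0)"
    by (intro tendsto_rabs tendsto_directional_deriv_norm)
  show ?A
    by (rule tendsto_upperbound[OF lim])
      (auto intro!: eventually_at_rightI[of 0 1] simp del: abs_divide simp: norm_quotient_bound)
  show ?B
    using norm_quotient_mono[of _ 1 x h]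
    by (intro tendsto_upperbound[OF tendsto_directional_deriv_norm] eventually_at_rightI[of 0 1])
       auto
qed

text \<open>Translates the derivative in the convexity hypothesis into that of the norm. Away from
  \<open>0\<close> this is the chain rule; at \<open>x = 0\<close> both sides vanish because
  \<open>q > 1\<close>.\<close>

lemma directional_deriv_norm_powr:
  fixes x h :: "'x::real_normed_vector"
  assumes q: "1 < q"
  shows "directional_deriv (\<lambda>y. norm y powr q) x h
         = q * norm x powr (q - 1) * directional_deriv norm x h"
proof -
  have "((\<lambda>t. (norm (x + t *\<^sub>R h) powr q - norm x powr q) / t)
          \<longlongrightarrow> q * norm x powr (q - 1) * directional_deriv norm x h) (at_right 0)"
  proof (cases "x = 0")
    case True
    have "((\<lambda>t. t powr (q - 1) * norm h powr q) \<longlongrightarrow> 0 powr (q - 1) * norm h powr q) (at_right 0)"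
      using q by (intro tendsto_intros) (auto simp: eventually_at_filter)
    moreover have "\<forall>\<^sub>F t in at_right 0. t powr (q - 1) * norm h powr q = norm (t *\<^sub>R h) powr q / t"
      by (rule eventually_at_rightI[of 0 1]) (auto simp: powr_mult powr_diff)
    ultimately show ?thesis
      using True by (auto intro: Lim_transform_eventually)
  next
    case False
    \<comment> \<open>A limit of quotients from the right is a derivative within
      \<open>{0<..}\<close>, which makes the chain rule applicable.\<close>
    have "((\<lambda>t. norm (x + t *\<^sub>R h)) has_real_derivative directional_deriv norm x h) (at 0 within {0<..})"
      using tendsto_directional_deriv_norm[of x h] by (simp add: has_field_derivative_iff)
    moreover have "((\<lambda>r. r powr q) has_real_derivative q * norm x powr (q - 1))
                     (at (norm (x + 0 *\<^sub>R h)))"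
      using False has_real_derivative_powr[of "norm x" q] by simp
    ultimately show ?thesis
      using DERIV_chain2 by (fastforce simp: has_field_derivative_iff)
  qed
  then show ?thesis
    unfolding directional_deriv_def by (simp add: tendsto_Lim)
qed

section \<open>The strong Bochner integral\<close>

lemma strongly_measurable_norm:
  fixes f :: "'w \<Rightarrow> 'x::real_normed_vector"
  assumes "strongly_measurable M f"
  shows "(\<lambda>\<omega>. norm (f \<omega>)) \<in> borel_measurable M"
proof -
  obtain s where s: "\<And>i::nat. simple_function M (s i)" "\<And>\<omega>. \<omega> \<in> space M \<Longrightarrow> (\<lambda>i. s i \<omega>) \<longlonglongrightarrow> f \<omega>"
    using assms unfolding strongly_measurable_def by blast
  show ?thesis
    by (rule borel_measurable_LIMSEQ_real[where u = "\<lambda>i \<omega>. norm (s i \<omega>)"])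
       (auto intro!: tendsto_norm s borel_measurable_simple_function simple_function_compose1[where g = norm])
qed

lemma strongly_measurable_lincomb:
  fixes f g :: "'w \<Rightarrow> 'x::real_normed_vector"
  assumes "strongly_measurable M f" and "strongly_measurable M g"
  shows "strongly_measurable M (\<lambda>\<omega>. a *\<^sub>R f \<omega> + b *\<^sub>R g \<omega>)"
proof -
  obtain s r where s: "\<And>i::nat. simple_function M (s i)" "\<And>\<omega>. \<omega> \<in> space M \<Longrightarrow> (\<lambda>i. s i \<omega>) \<longlonglongrightarrow> f \<omega>"
    and r: "\<And>i::nat. simple_function M (r i)" "\<And>\<omega>. \<omega> \<in> space M \<Longrightarrow> (\<lambda>i. r i \<omega>) \<longlonglongrightarrow> g \<omega>"
    using assms unfolding strongly_measurable_def by blast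
  have "simple_function M (\<lambda>\<omega>. a *\<^sub>R s i \<omega> + b *\<^sub>R r i \<omega>)" for i
    by (intro simple_function_compose2[where h = "\<lambda>x y. a *\<^sub>R x + b *\<^sub>R y"] s r)
  moreover have "(\<lambda>i. a *\<^sub>R s i \<omega> + b *\<^sub>R r i \<omega>) \<longlonglongrightarrow> a *\<^sub>R f \<omega> + b *\<^sub>R g \<omega>" if "\<omega> \<in> space M" for \<omega>
    using that by (intro tendsto_intros s r)
  ultimately show ?thesis
    unfolding strongly_measurable_def by (intro exI[of _ "\<lambda>i \<omega>. a *\<^sub>R s i \<omega> + b *\<^sub>R r i \<omega>"]) blast
qed

lemma strongly_measurable_diff:
  fixes f g :: "'w \<Rightarrow> 'x::real_normed_vector"
  assumes "strongly_measurable M f" and "strongly_measurable M g"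
  shows "strongly_measurable M (\<lambda>\<omega>. f \<omega> - g \<omega>)"
  using strongly_measurable_lincomb[OF assms, of 1 "-1"] by simp

lemma strongly_measurable_simple_function:
  "simple_function M f \<Longrightarrow> strongly_measurable M f"
  unfolding strongly_measurable_def by (rule exI[of _ "\<lambda>_. f"]) auto

lemma simple_function_subalgebra:
  assumes "subalgebra M G" and "simple_function G f"
  shows "simple_function M f"
  using assms unfolding simple_function_def subalgebra_def by auto

lemma strongly_measurable_subalgebra:
  assumes "subalgebra M G" and "strongly_measurable G f"
  shows "strongly_measurable M f"
  using assms simple_function_subalgebra[OF assms(1)]
  unfolding strongly_measurable_def subalgebra_def by metis

lemma simple_bochner_integrable_imp_simple_function:
  "Bochner_Integration.simple_bochner_integrable M s \<Longrightarrow> simple_function M s"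
  by (auto elim: simple_bochner_integrable.cases)

lemma borel_measurable_norm_diff_simple:
  fixes f s :: "'w \<Rightarrow> 'x::real_normed_vector"
  assumes "strongly_measurable M f" and "Bochner_Integration.simple_bochner_integrable M s"
  shows "(\<lambda>\<omega>. norm (f \<omega> - s \<omega>)) \<in> borel_measurable M"
  by (rule strongly_measurable_norm[OF strongly_measurable_diff[OF assms(1)
        strongly_measurable_simple_function[OF simple_bochner_integrable_imp_simple_function[OF assms(2)]]]])

lemma has_strong_bochner_integral_lincomb:
  fixes f g :: "'w \<Rightarrow> 'x::real_normed_vector"
  assumes "has_strong_bochner_integral M f u" and "has_strong_bochner_integral M g v"
  shows "has_strong_bochner_integral M (\<lambda>\<omega>. a *\<^sub>R f \<omega> + b *\<^sub>R g \<omega>) (a *\<^sub>R u + b *\<^sub>R v)"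
proof -
  from assms obtain s r
    where f: "strongly_measurable M f" and g: "strongly_measurable M g"
      and s: "\<And>i::nat. Bochner_Integration.simple_bochner_integrable M (s i)"
        "(\<lambda>i. \<integral>\<^sup>+\<omega>. ennreal (norm (f \<omega> - s i \<omega>)) \<partial>M) \<longlonglongrightarrow> 0"
        "(\<lambda>i. Bochner_Integration.simple_bochner_integral M (s i)) \<longlonglongrightarrow> u"
      and r: "\<And>i::nat. Bochner_Integration.simple_bochner_integrable M (r i)"
        "(\<lambda>i. \<integral>\<^sup>+\<omega>. ennreal (norm (g \<omega> - r i \<omega>)) \<partial>M) \<longlonglongrightarrow> 0"
        "(\<lambda>i. Bochner_Integration.simple_bochner_integral M (r i)) \<longlonglongrightarrow> v"
    unfolding has_strong_bochner_integral_def by blast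
  define z where "z i \<omega> = a *\<^sub>R s i \<omega> + b *\<^sub>R r i \<omega>" for i \<omega>
  have sc: "Bochner_Integration.simple_bochner_integrable M (\<lambda>\<omega>. c *\<^sub>R y \<omega>)"
    if "Bochner_Integration.simple_bochner_integrable M y" for c and y :: "'w \<Rightarrow> 'x"
    using simple_bochner_integrable_compose2[of "\<lambda>x _. c *\<^sub>R x" M y y] that by simp
  have z: "Bochner_Integration.simple_bochner_integrable M (z i)" for i
    unfolding z_def
    by (intro simple_bochner_integrable_compose2[where p = "\<lambda>x y. a *\<^sub>R x + b *\<^sub>R y"] s r) simp
  have "Bochner_Integration.simple_bochner_integral M (z i)
      = a *\<^sub>R Bochner_Integration.simple_bochner_integral M (s i) + b *\<^sub>R Bochner_Integration.simple_bochner_integral M (r i)" for i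
    unfolding z_def using s(1) r(1)
    by (subst simple_bochner_integral_add)
       (auto simp: sc simple_bochner_integral_linear[OF linear_scaleR])
  then have lim: "(\<lambda>i. Bochner_Integration.simple_bochner_integral M (z i)) \<longlonglongrightarrow> a *\<^sub>R u + b *\<^sub>R v"
    using s(3) r(3) by (simp add: tendsto_add tendsto_scaleR)
  have upper: "(\<integral>\<^sup>+\<omega>. ennreal (norm (a *\<^sub>R f \<omega> + b *\<^sub>R g \<omega> - z i \<omega>)) \<partial>M)
      \<le> ennreal \<bar>a\<bar> * (\<integral>\<^sup>+\<omega>. ennreal (norm (f \<omega> - s i \<omega>)) \<partial>M)
        + ennreal \<bar>b\<bar> * (\<integral>\<^sup>+\<omega>. ennreal (norm (g \<omega> - r i \<omega>)) \<partial>M)" for i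
  proof -
    have [measurable]: "(\<lambda>\<omega>. norm (f \<omega> - s i \<omega>)) \<in> borel_measurable M"
      "(\<lambda>\<omega>. norm (g \<omega> - r i \<omega>)) \<in> borel_measurable M"
      using f g s(1) r(1) by (auto intro: borel_measurable_norm_diff_simple)
    have "a *\<^sub>R f \<omega> + b *\<^sub>R g \<omega> - z i \<omega> = a *\<^sub>R (f \<omega> - s i \<omega>) + b *\<^sub>R (g \<omega> - r i \<omega>)" for \<omega>
      by (simp add: z_def algebra_simps)
    note decomp = this
    have "norm (a *\<^sub>R f \<omega> + b *\<^sub>R g \<omega> - z i \<omega>)
        \<le> \<bar>a\<bar> * norm (f \<omega> - s i \<omega>) + \<bar>b\<bar> * norm (g \<omega> - r i \<omega>)" for \<omega>
      using norm_triangle_ineq[of "a *\<^sub>R (f \<omega> - s i \<omega>)" "b *\<^sub>R (g \<omega> - r i \<omega>)"]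
      unfolding decomp[of \<omega>] by simp
    then have "(\<integral>\<^sup>+\<omega>. ennreal (norm (a *\<^sub>R f \<omega> + b *\<^sub>R g \<omega> - z i \<omega>)) \<partial>M)
      \<le> (\<integral>\<^sup>+\<omega>. ennreal \<bar>a\<bar> * ennreal (norm (f \<omega> - s i \<omega>)) + ennreal \<bar>b\<bar> * ennreal (norm (g \<omega> - r i \<omega>)) \<partial>M)"
      by (intro nn_integral_mono) (simp add: ennreal_leI flip: ennreal_mult'' ennreal_plus)
    then show ?thesis
      by (simp add: nn_integral_add nn_integral_cmult)
  qed
  have "(\<lambda>i. ennreal \<bar>a\<bar> * (\<integral>\<^sup>+\<omega>. ennreal (norm (f \<omega> - s i \<omega>)) \<partial>M)
        + ennreal \<bar>b\<bar> * (\<integral>\<^sup>+\<omega>. ennreal (norm (g \<omega> - r i \<omega>)) \<partial>M)) \<longlonglongrightarrow> ennreal \<bar>a\<bar> * 0 + ennreal \<bar>b\<bar> * 0"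
    by (intro tendsto_add ennreal_tendsto_cmult s r) auto
  then have "(\<lambda>i. ennreal \<bar>a\<bar> * (\<integral>\<^sup>+\<omega>. ennreal (norm (f \<omega> - s i \<omega>)) \<partial>M)
        + ennreal \<bar>b\<bar> * (\<integral>\<^sup>+\<omega>. ennreal (norm (g \<omega> - r i \<omega>)) \<partial>M)) \<longlonglongrightarrow> 0"
    by simp
  from tendsto_sandwich[OF _ _ tendsto_const this] upper
  have conv: "(\<lambda>i. \<integral>\<^sup>+\<omega>. ennreal (norm (a *\<^sub>R f \<omega> + b *\<^sub>R g \<omega> - z i \<omega>)) \<partial>M) \<longlonglongrightarrow> 0"
    by simp
  show ?thesis
    unfolding has_strong_bochner_integral_def
    by (intro conjI exI[of _ z] allI strongly_measurable_lincomb f g z conv lim)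
qed

lemma has_strong_bochner_integral_simple:
  assumes "Bochner_Integration.simple_bochner_integrable M s"
  shows "has_strong_bochner_integral M s (Bochner_Integration.simple_bochner_integral M s)"
  unfolding has_strong_bochner_integral_def
  using assms simple_bochner_integrable_imp_simple_function[OF assms]
  by (auto intro!: strongly_measurable_simple_function exI[of _ "\<lambda>_. s"])

lemma has_strong_bochner_integral_indicator:
  fixes c :: "'x::real_normed_vector"
  assumes [measurable]: "B \<in> sets M" and "emeasure M B \<noteq> \<infinity>"
  shows "has_strong_bochner_integral M (\<lambda>\<omega>. indicator B \<omega> *\<^sub>R c) (measure M B *\<^sub>R c)"
proof -
  have sf: "simple_function M (\<lambda>\<omega>. indicator B \<omega> *\<^sub>R c)"
    by (intro simple_function_compose1[where g = "\<lambda>x. x *\<^sub>R c"] simple_function_indicator) simp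
  have "emeasure M {\<omega> \<in> space M. indicator B \<omega> *\<^sub>R c \<noteq> 0} \<le> emeasure M B"
    by (intro emeasure_mono) (auto simp: indicator_def)
  then have si: "Bochner_Integration.simple_bochner_integrable M (\<lambda>\<omega>. indicator B \<omega> *\<^sub>R c)"
    using sf assms by (auto intro!: simple_bochner_integrable.intros simp: top_unique)
  have "Bochner_Integration.simple_bochner_integral M (\<lambda>\<omega>. indicator B \<omega> *\<^sub>R c)
      = (\<Sum>y\<in>indicator B ` space M. measure M {\<omega> \<in> space M. indicator B \<omega> = y} *\<^sub>R y *\<^sub>R c)"
    by (intro simple_bochner_integral_partition[OF si, where g = "indicator B"]) auto
  \<comment> \<open>The indicator may be constant on the space; a value in \<open>{0, 1}\<close>
    that it does not take contributes the measure of the empty set.\<close>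
  also have "\<dots> = (\<Sum>y\<in>{0, 1::real}. measure M {\<omega> \<in> space M. indicator B \<omega> = y} *\<^sub>R y *\<^sub>R c)"
  proof (rule sum.mono_neutral_left)
    show "\<forall>y\<in>{0, 1::real} - indicator B ` space M.
        measure M {\<omega> \<in> space M. indicator B \<omega> = y} *\<^sub>R y *\<^sub>R c = 0"
    proof
      fix y :: real
      assume "y \<in> {0, 1} - indicator B ` space M"
      then have "{\<omega> \<in> space M. indicator B \<omega> = y} = {}" by auto
      then show "measure M {\<omega> \<in> space M. indicator B \<omega> = y} *\<^sub>R y *\<^sub>R c = 0"
        by (metis measure_empty scaleR_zero_left)
    qed
  qed (auto simp: indicator_def)
  also have "{\<omega> \<in> space M. indicator B \<omega> = (1::real)} = B"
    using sets.sets_into_space[OF assms(1)] by (auto simp: indicator_def)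
  then have "(\<Sum>y\<in>{0, 1::real}. measure M {\<omega> \<in> space M. indicator B \<omega> = y} *\<^sub>R y *\<^sub>R c) = measure M B *\<^sub>R c"
    by simp
  finally show ?thesis
    using has_strong_bochner_integral_simple[OF si] by simp
qed

text \<open>The triangle inequality for simple integrals passes to the limit, because the
  approximants converge to \<open>f\<close> in mean.\<close>

lemma has_strong_bochner_integral_norm_bound:
  fixes f :: "'w \<Rightarrow> 'x::real_normed_vector"
  assumes "has_strong_bochner_integral M f u"
  shows "ennreal (norm u) \<le> (\<integral>\<^sup>+\<omega>. ennreal (norm (f \<omega>)) \<partial>M)"
proof -
  from assms obtain s
    where f: "strongly_measurable M f"
      and s: "\<And>i::nat. Bochner_Integration.simple_bochner_integrable M (s i)"
        "(\<lambda>i. \<integral>\<^sup>+\<omega>. ennreal (norm (f \<omega> - s i \<omega>)) \<partial>M) \<longlonglongrightarrow> 0"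
        "(\<lambda>i. Bochner_Integration.simple_bochner_integral M (s i)) \<longlonglongrightarrow> u"
    unfolding has_strong_bochner_integral_def by blast
  have "ennreal (norm (Bochner_Integration.simple_bochner_integral M (s i)))
      \<le> (\<integral>\<^sup>+\<omega>. ennreal (norm (f \<omega>)) \<partial>M) + (\<integral>\<^sup>+\<omega>. ennreal (norm (f \<omega> - s i \<omega>)) \<partial>M)" for i
  proof -
    have n: "Bochner_Integration.simple_bochner_integrable M (\<lambda>\<omega>. norm (s i \<omega>))"
      using simple_bochner_integrable_compose2[of "\<lambda>x _. norm x" M "s i" "s i"] s(1) by simp
    have [measurable]: "(\<lambda>\<omega>. norm (f \<omega>)) \<in> borel_measurable M"
        "(\<lambda>\<omega>. norm (f \<omega> - s i \<omega>)) \<in> borel_measurable M"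
      using f s(1) by (auto intro: strongly_measurable_norm borel_measurable_norm_diff_simple)
    have "ennreal (norm (Bochner_Integration.simple_bochner_integral M (s i))) \<le> Bochner_Integration.simple_bochner_integral M (\<lambda>\<omega>. norm (s i \<omega>))"
      by (intro ennreal_leI simple_bochner_integral_norm_bound s)
    also have "\<dots> = (\<integral>\<^sup>+\<omega>. ennreal (norm (s i \<omega>)) \<partial>M)"
      by (rule simple_bochner_integral_eq_nn_integral[OF n]) simp
    also have "\<dots> \<le> (\<integral>\<^sup>+\<omega>. ennreal (norm (f \<omega>)) + ennreal (norm (f \<omega> - s i \<omega>)) \<partial>M)"
    proof (intro nn_integral_mono)
      fix \<omega>
      have "norm (s i \<omega>) \<le> norm (f \<omega>) + norm (f \<omega> - s i \<omega>)"
        using norm_triangle_sub[of "s i \<omega>" "f \<omega>"] by (simp add: norm_minus_commute)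
      then show "ennreal (norm (s i \<omega>)) \<le> ennreal (norm (f \<omega>)) + ennreal (norm (f \<omega> - s i \<omega>))"
        by (simp flip: ennreal_plus)
    qed
    also have "\<dots> = (\<integral>\<^sup>+\<omega>. ennreal (norm (f \<omega>)) \<partial>M) + (\<integral>\<^sup>+\<omega>. ennreal (norm (f \<omega> - s i \<omega>)) \<partial>M)"
      by (rule nn_integral_add) auto
    finally show ?thesis .
  qed
  then have bound: "\<exists>N. \<forall>i\<ge>N. ennreal (norm (Bochner_Integration.simple_bochner_integral M (s i)))
      \<le> (\<integral>\<^sup>+\<omega>. ennreal (norm (f \<omega>)) \<partial>M) + (\<integral>\<^sup>+\<omega>. ennreal (norm (f \<omega> - s i \<omega>)) \<partial>M)"
    by blast
  have 1: "(\<lambda>i. ennreal (norm (Bochner_Integration.simple_bochner_integral M (s i)))) \<longlonglongrightarrow> ennreal (norm u)"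
    by (intro tendsto_intros s)
  have 2: "(\<lambda>i. (\<integral>\<^sup>+\<omega>. ennreal (norm (f \<omega>)) \<partial>M) + (\<integral>\<^sup>+\<omega>. ennreal (norm (f \<omega> - s i \<omega>)) \<partial>M))
      \<longlonglongrightarrow> (\<integral>\<^sup>+\<omega>. ennreal (norm (f \<omega>)) \<partial>M) + 0"
    by (intro tendsto_add tendsto_const s)
  show ?thesis
    using LIMSEQ_le[OF 1 2 bound] by simp
qed

text \<open>One approximant at mean distance below \<open>1\<close> suffices, since the norm of an
  integrable simple function has a finite integral.\<close>

lemma has_strong_bochner_integral_finite:
  fixes f :: "'w \<Rightarrow> 'x::real_normed_vector"
  assumes "has_strong_bochner_integral M f u"
  shows "(\<integral>\<^sup>+\<omega>. ennreal (norm (f \<omega>)) \<partial>M) < \<infinity>"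
proof -
  from assms obtain s
    where f: "strongly_measurable M f"
      and s: "\<And>i::nat. Bochner_Integration.simple_bochner_integrable M (s i)"
        "(\<lambda>i. \<integral>\<^sup>+\<omega>. ennreal (norm (f \<omega> - s i \<omega>)) \<partial>M) \<longlonglongrightarrow> 0"
    unfolding has_strong_bochner_integral_def by blast
  from order_tendstoD(2)[OF s(2), of 1] obtain i
    where i: "(\<integral>\<^sup>+\<omega>. ennreal (norm (f \<omega> - s i \<omega>)) \<partial>M) < 1"
    by (auto simp: eventually_sequentially)
  have n: "Bochner_Integration.simple_bochner_integrable M (\<lambda>\<omega>. norm (s i \<omega>))"
    using simple_bochner_integrable_compose2[of "\<lambda>x _. norm x" M "s i" "s i"] s(1) by simp
  note [measurable] = borel_measurable_norm_diff_simple[OF f s(1)] strongly_measurable_norm[OF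
    strongly_measurable_simple_function[OF simple_bochner_integrable_imp_simple_function[OF s(1)]]]
  have "(\<integral>\<^sup>+\<omega>. ennreal (norm (f \<omega>)) \<partial>M) \<le> (\<integral>\<^sup>+\<omega>. ennreal (norm (s i \<omega>)) + ennreal (norm (f \<omega> - s i \<omega>)) \<partial>M)"
    by (intro nn_integral_mono) (simp add: norm_triangle_sub flip: ennreal_plus)
  also have "\<dots> = ennreal (Bochner_Integration.simple_bochner_integral M (\<lambda>\<omega>. norm (s i \<omega>))) + (\<integral>\<^sup>+\<omega>. ennreal (norm (f \<omega> - s i \<omega>)) \<partial>M)"
    by (subst simple_bochner_integral_eq_nn_integral[OF n]) (auto intro!: nn_integral_add)
  also have "\<dots> < \<infinity>"
    using order.strict_trans[OF i] by simp
  finally show ?thesis .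
qed

section \<open>Conditional Jensen inequality for the norm\<close>

text \<open>Jensen's inequality for a constant: \<open>f\<close> and \<open>g\<close> have the same
  integral over \<open>B\<close>, so \<open>c + t *\<^sub>R (f \<omega> - g \<omega>)\<close>
  integrates over \<open>B\<close> to \<open>measure M B *\<^sub>R c\<close>, and the norm bound
  applies.\<close>

lemma norm_mult_emeasure_le:
  fixes f g :: "'w \<Rightarrow> 'x::real_normed_vector"
  assumes "finite_measure M" and B: "B \<in> sets M"
    and f: "has_strong_bochner_integral M (\<lambda>\<omega>. indicator B \<omega> *\<^sub>R f \<omega>) v"
    and g: "has_strong_bochner_integral M (\<lambda>\<omega>. indicator B \<omega> *\<^sub>R g \<omega>) v"
  shows "ennreal (norm c) * emeasure M B
         \<le> (\<integral>\<^sup>+\<omega>. indicator B \<omega> * ennreal (norm (c + t *\<^sub>R (f \<omega> - g \<omega>))) \<partial>M)"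
proof -
  interpret finite_measure M by fact
  have c: "has_strong_bochner_integral M (\<lambda>\<omega>. indicator B \<omega> *\<^sub>R c) (measure M B *\<^sub>R c)"
    using B by (intro has_strong_bochner_integral_indicator) auto
  from has_strong_bochner_integral_lincomb[OF c
      has_strong_bochner_integral_lincomb[OF f g, of t "-t"], of 1 1]
  have "ennreal (norm (measure M B *\<^sub>R c))
      \<le> (\<integral>\<^sup>+\<omega>. ennreal (norm (indicator B \<omega> *\<^sub>R c + (t *\<^sub>R indicator B \<omega> *\<^sub>R f \<omega> + (- t) *\<^sub>R indicator B \<omega> *\<^sub>R g \<omega>))) \<partial>M)"
    using has_strong_bochner_integral_norm_bound by fastforce
  also have "\<dots> = (\<integral>\<^sup>+\<omega>. indicator B \<omega> * ennreal (norm (c + t *\<^sub>R (f \<omega> - g \<omega>))) \<partial>M)"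
    by (intro nn_integral_cong) (auto simp: indicator_def algebra_simps)
  finally show ?thesis
    by (simp add: emeasure_eq_measure mult.commute flip: ennreal_mult)
qed

text \<open>Pointwise convergence alone gives no control of size. Cutting the approximants off
  relative to \<open>g\<close> makes dominated convergence available.\<close>

lemma strongly_measurable_dominated_approx:
  fixes g :: "'w \<Rightarrow> 'x::real_normed_vector"
  assumes "strongly_measurable G g"
  obtains s where "\<And>i::nat. simple_function G (s i)"
    and "\<And>\<omega>. \<omega> \<in> space G \<Longrightarrow> (\<lambda>i. s i \<omega>) \<longlonglongrightarrow> g \<omega>"
    and "\<And>i \<omega>. norm (s i \<omega>) \<le> 2 * norm (g \<omega>)"
proof -
  obtain r where r: "\<And>i::nat. simple_function G (r i)" "\<And>\<omega>. \<omega> \<in> space G \<Longrightarrow> (\<lambda>i. r i \<omega>) \<longlonglongrightarrow> g \<omega>"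
    using assms unfolding strongly_measurable_def by blast
  \<comment> \<open>Where \<open>g\<close> is nonzero the norm of \<open>r i\<close> is eventually
    below \<open>2 * norm (g \<omega>)\<close>, so the cut-off stops acting; where \<open>g\<close>
    vanishes it forces the value \<open>0\<close>.\<close>
  define s where "s i \<omega> = (if norm (r i \<omega>) \<le> 2 * norm (g \<omega>) then r i \<omega> else 0)" for i \<omega>
  note [measurable] = strongly_measurable_norm[OF assms]
  have [measurable]: "(\<lambda>\<omega>. norm (r i \<omega>)) \<in> borel_measurable G" for i
    by (intro strongly_measurable_norm strongly_measurable_simple_function r)
  show thesis
  proof (rule that[of s])
    show "simple_function G (s i)" for i
      unfolding s_def by (intro simple_function_If r simple_function_const) measurable
    show "norm (s i \<omega>) \<le> 2 * norm (g \<omega>)" for i \<omega>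
      by (simp add: s_def)
    fix \<omega> assume \<omega>: "\<omega> \<in> space G"
    show "(\<lambda>i. s i \<omega>) \<longlonglongrightarrow> g \<omega>"
    proof (cases "g \<omega> = 0")
      case True
      then have "s i \<omega> = 0" for i by (simp add: s_def)
      with True show ?thesis by simp
    next
      case False
      then have "\<forall>\<^sub>F i in sequentially. norm (r i \<omega>) < 2 * norm (g \<omega>)"
        by (intro order_tendstoD(2)[OF tendsto_norm[OF r(2)[OF \<omega>]]]) simp
      then have "\<forall>\<^sub>F i in sequentially. r i \<omega> = s i \<omega>"
        by eventually_elim (simp add: s_def)
      with r(2)[OF \<omega>] show ?thesis
        by (rule Lim_transform_eventually)
    qed
  qed
qed

context
  fixes M G :: "'w measure" and f g :: "'w \<Rightarrow> 'x::real_normed_vector"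
  assumes fin: "finite_measure M" and sub: "subalgebra M G"
    and f: "strongly_measurable M f" and ce: "is_cond_expectation M G f g"
begin

private lemma g_measurable: "strongly_measurable G g" "strongly_measurable M g"
  using ce sub strongly_measurable_subalgebra unfolding is_cond_expectation_def by blast+

private lemma perturbation_measurable:
  assumes "strongly_measurable M s"
  shows "(\<lambda>\<omega>. norm (s \<omega> + t *\<^sub>R (f \<omega> - g \<omega>))) \<in> borel_measurable M"
  using strongly_measurable_norm[OF strongly_measurable_lincomb[OF assms
      strongly_measurable_diff[OF f g_measurable(2)], of 1 t]] by simp

text \<open>The level sets of \<open>s\<close> within \<open>A\<close> belong to \<open>G\<close>,
  and \<open>s\<close> is constant on each of them, so \<open>norm_mult_emeasure_le\<close> can be
  summed over the finitely many values.\<close>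

private lemma cond_jensen_simple:
  assumes s: "simple_function G s" and A: "A \<in> sets G"
  shows "(\<integral>\<^sup>+\<omega>. indicator A \<omega> * ennreal (norm (s \<omega>)) \<partial>M)
       \<le> (\<integral>\<^sup>+\<omega>. indicator A \<omega> * ennreal (norm (s \<omega> + t *\<^sub>R (f \<omega> - g \<omega>))) \<partial>M)"
proof -
  have sp: "space G = space M" and sets: "sets G \<subseteq> sets M"
    using sub by (auto simp: subalgebra_def)
  define R where "R = s ` space M"
  define B where "B c = A \<inter> (s -` {c} \<inter> space M)" for c
  have BG: "B c \<in> sets G" if "c \<in> R" for c
    using s A that unfolding simple_function_def R_def B_def sp by auto
  have finR: "finite R"
    using s unfolding simple_function_def R_def sp by auto
  have B: "B c \<in> sets M" if "c \<in> R" for c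
    using BG[OF that] sets by auto
  \<comment> \<open>\<open>\<phi>\<close> is general because the identity is used both for the norm
    and for the perturbed norm, where \<open>\<phi>\<close> itself varies with
    \<open>\<omega>\<close>.\<close>
  have decomp: "indicator A \<omega> * \<phi> (s \<omega>) = (\<Sum>c\<in>R. indicator (B c) \<omega> * \<phi> c)"
    if "\<omega> \<in> space M" for \<omega> and \<phi> :: "'x \<Rightarrow> ennreal"
  proof -
    have "(\<Sum>c\<in>R. indicator (B c) \<omega> * \<phi> c) = (\<Sum>c\<in>R. if s \<omega> = c then indicator A \<omega> * \<phi> c else 0)"
      using that by (intro sum.cong) (auto simp: B_def indicator_def)
    also have "\<dots> = indicator A \<omega> * \<phi> (s \<omega>)"
      using finR that by (subst sum.delta') (auto simp: R_def)
    finally show ?thesis by simp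
  qed
  have "(\<integral>\<^sup>+\<omega>. indicator A \<omega> * ennreal (norm (s \<omega>)) \<partial>M)
      = (\<integral>\<^sup>+\<omega>. (\<Sum>c\<in>R. indicator (B c) \<omega> * ennreal (norm c)) \<partial>M)"
    by (intro nn_integral_cong decomp)
  also have "\<dots> = (\<Sum>c\<in>R. ennreal (norm c) * emeasure M (B c))"
    using B by (simp add: nn_integral_sum nn_integral_cmult_indicator mult.commute[of "indicator _ _"])
  also have "\<dots> \<le> (\<Sum>c\<in>R. \<integral>\<^sup>+\<omega>. indicator (B c) \<omega> * ennreal (norm (c + t *\<^sub>R (f \<omega> - g \<omega>))) \<partial>M)"
  proof (rule sum_mono)
    fix c assume c: "c \<in> R"
    then obtain v where "has_strong_bochner_integral M (\<lambda>\<omega>. indicator (B c) \<omega> *\<^sub>R f \<omega>) v"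
      "has_strong_bochner_integral M (\<lambda>\<omega>. indicator (B c) \<omega> *\<^sub>R g \<omega>) v"
      using ce BG unfolding is_cond_expectation_def by blast
    with fin B[OF c] show "ennreal (norm c) * emeasure M (B c)
        \<le> (\<integral>\<^sup>+\<omega>. indicator (B c) \<omega> * ennreal (norm (c + t *\<^sub>R (f \<omega> - g \<omega>))) \<partial>M)"
      by (rule norm_mult_emeasure_le)
  qed
  also have "\<dots> = (\<integral>\<^sup>+\<omega>. (\<Sum>c\<in>R. indicator (B c) \<omega> * ennreal (norm (c + t *\<^sub>R (f \<omega> - g \<omega>)))) \<partial>M)"
  proof (rule nn_integral_sum[symmetric])
    fix c assume "c \<in> R"
    note [measurable] = B[OF this] perturbation_measurable[OF
      strongly_measurable_simple_function[OF simple_function_const[of M c]]]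
    show "(\<lambda>\<omega>. indicator (B c) \<omega> * ennreal (norm (c + t *\<^sub>R (f \<omega> - g \<omega>)))) \<in> borel_measurable M"
      by measurable
  qed
  also have "\<dots> = (\<integral>\<^sup>+\<omega>. indicator A \<omega> * ennreal (norm (s \<omega> + t *\<^sub>R (f \<omega> - g \<omega>))) \<partial>M)"
    by (intro nn_integral_cong decomp[symmetric])
  finally show ?thesis .
qed

text \<open>\<open>g\<close> is replaced by simple functions \<open>s i\<close>, once on each side.
  Each replacement costs at most the mean distance \<open>\<epsilon> i\<close>, which tends to
  \<open>0\<close>.\<close>

private lemma cond_jensen_set:
  assumes A: "A \<in> sets G"
  shows "(\<integral>\<^sup>+\<omega>. indicator A \<omega> * ennreal (norm (g \<omega>)) \<partial>M)
       \<le> (\<integral>\<^sup>+\<omega>. indicator A \<omega> * ennreal (norm (g \<omega> + t *\<^sub>R (f \<omega> - g \<omega>))) \<partial>M)" (is "?l \<le> ?r")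
proof -
  have sp: "space G = space M" and [measurable]: "A \<in> sets M"
    using sub A by (auto simp: subalgebra_def)
  obtain s where s: "\<And>i::nat. simple_function G (s i)"
    and lim: "\<And>\<omega>. \<omega> \<in> space M \<Longrightarrow> (\<lambda>i. s i \<omega>) \<longlonglongrightarrow> g \<omega>"
    and dom: "\<And>i \<omega>. norm (s i \<omega>) \<le> 2 * norm (g \<omega>)"
    using strongly_measurable_dominated_approx[OF g_measurable(1)] unfolding sp by metis
  have sM: "strongly_measurable M (s i)" for i
    by (intro strongly_measurable_simple_function simple_function_subalgebra[OF sub] s)
  note [measurable] = strongly_measurable_norm[OF g_measurable(2)] strongly_measurable_norm[OF sM]
    strongly_measurable_norm[OF strongly_measurable_diff[OF g_measurable(2) sM]]
    perturbation_measurable[OF g_measurable(2)] perturbation_measurable[OF sM]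
  obtain v where v: "has_strong_bochner_integral M (\<lambda>\<omega>. indicator (space M) \<omega> *\<^sub>R g \<omega>) v"
    using ce sets.top[of G] unfolding is_cond_expectation_def sp by blast
  have "(\<integral>\<^sup>+\<omega>. ennreal (norm (g \<omega>)) \<partial>M) = (\<integral>\<^sup>+\<omega>. ennreal (norm (indicator (space M) \<omega> *\<^sub>R g \<omega>)) \<partial>M)"
    by (intro nn_integral_cong) simp
  also have "\<dots> < \<infinity>"
    by (rule has_strong_bochner_integral_finite[OF v])
  finally have g_fin: "(\<integral>\<^sup>+\<omega>. ennreal (norm (g \<omega>)) \<partial>M) < \<infinity>" .
  define \<epsilon> where "\<epsilon> i = (\<integral>\<^sup>+\<omega>. ennreal (norm (g \<omega> - s i \<omega>)) \<partial>M)" for i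
  have "\<epsilon> \<longlonglongrightarrow> (\<integral>\<^sup>+\<omega>. 0 \<partial>M)"
    unfolding \<epsilon>_def
  \<comment> \<open>The factor \<open>3\<close> is \<open>1 + 2\<close>, from \<open>g\<close>
    itself and from the bound on \<open>s i\<close>.\<close>
  proof (rule nn_integral_dominated_convergence[where w = "\<lambda>\<omega>. 3 * ennreal (norm (g \<omega>))"])
    have "norm (g \<omega> - s i \<omega>) \<le> 3 * norm (g \<omega>)" for i \<omega>
      using dom[of i \<omega>] norm_triangle_ineq4[of "g \<omega>" "s i \<omega>"] by simp
    then have "ennreal (norm (g \<omega> - s i \<omega>)) \<le> ennreal (3 * norm (g \<omega>))" for i \<omega>
      by (rule ennreal_leI)
    then show "AE \<omega> in M. ennreal (norm (g \<omega> - s i \<omega>)) \<le> 3 * ennreal (norm (g \<omega>))" for i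
      by (simp add: ennreal_mult)
    show "(\<integral>\<^sup>+\<omega>. 3 * ennreal (norm (g \<omega>)) \<partial>M) < \<infinity>"
      using g_fin by (simp add: nn_integral_cmult ennreal_mult_less_top)
    have "(\<lambda>i. ennreal (norm (g \<omega> - s i \<omega>))) \<longlonglongrightarrow> ennreal (norm (g \<omega> - g \<omega>))" if "\<omega> \<in> space M" for \<omega>
      by (intro tendsto_intros lim that)
    then show "AE \<omega> in M. (\<lambda>i. ennreal (norm (g \<omega> - s i \<omega>))) \<longlonglongrightarrow> 0"
      by (intro AE_I2) simp
  qed measurable
  then have \<epsilon>: "\<epsilon> \<longlonglongrightarrow> 0" by simp
  have bound: "?l \<le> ?r + \<epsilon> i + \<epsilon> i" for i
  proof -
    have le: "indicator A \<omega> * ennreal x \<le> indicator A \<omega> * ennreal y + ennreal z"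
      if "x \<le> y + z" "0 \<le> y" "0 \<le> z" for x y z :: real and \<omega>
      using that by (auto simp: indicator_def simp flip: ennreal_plus)
    have "?l \<le> (\<integral>\<^sup>+\<omega>. indicator A \<omega> * ennreal (norm (s i \<omega>)) + ennreal (norm (g \<omega> - s i \<omega>)) \<partial>M)"
      by (intro nn_integral_mono le) (auto intro: norm_triangle_sub)
    also have "\<dots> = (\<integral>\<^sup>+\<omega>. indicator A \<omega> * ennreal (norm (s i \<omega>)) \<partial>M) + \<epsilon> i"
      unfolding \<epsilon>_def by (rule nn_integral_add) measurable
    also have "\<dots> \<le> (\<integral>\<^sup>+\<omega>. indicator A \<omega> * ennreal (norm (s i \<omega> + t *\<^sub>R (f \<omega> - g \<omega>))) \<partial>M) + \<epsilon> i"
      by (intro add_right_mono cond_jensen_simple s A)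
    also have "\<dots> \<le> (\<integral>\<^sup>+\<omega>. indicator A \<omega> * ennreal (norm (g \<omega> + t *\<^sub>R (f \<omega> - g \<omega>)))
        + ennreal (norm (g \<omega> - s i \<omega>)) \<partial>M) + \<epsilon> i"
    proof (intro add_right_mono nn_integral_mono le)
      fix \<omega>
      have "s i \<omega> + t *\<^sub>R (f \<omega> - g \<omega>) = (g \<omega> + t *\<^sub>R (f \<omega> - g \<omega>)) - (g \<omega> - s i \<omega>)" by simp
      then show "norm (s i \<omega> + t *\<^sub>R (f \<omega> - g \<omega>)) \<le> norm (g \<omega> + t *\<^sub>R (f \<omega> - g \<omega>)) + norm (g \<omega> - s i \<omega>)"
        by (metis norm_triangle_ineq4)
    qed auto
    also have "\<dots> = ?r + \<epsilon> i + \<epsilon> i"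
      unfolding \<epsilon>_def by (subst nn_integral_add) measurable
    finally show ?thesis .
  qed
  have "(\<lambda>i. ?r + \<epsilon> i + \<epsilon> i) \<longlonglongrightarrow> ?r + 0 + 0"
    by (intro tendsto_add tendsto_const \<epsilon>)
  from LIMSEQ_le_const[OF this] bound show ?thesis
    by simp
qed

text \<open>Both sides are additive, homogeneous and continuous along increasing sequences in
  \<open>Z\<close>, so the case of indicators extends to all \<open>[0, \<infinity>]\<close>-valued
  weights that are measurable for \<open>G\<close>.\<close>

lemma cond_jensen_norm:
  assumes "Z \<in> borel_measurable G"
  shows "(\<integral>\<^sup>+\<omega>. Z \<omega> * ennreal (norm (g \<omega>)) \<partial>M)
       \<le> (\<integral>\<^sup>+\<omega>. Z \<omega> * ennreal (norm (g \<omega> + t *\<^sub>R (f \<omega> - g \<omega>))) \<partial>M)"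
  using assms
proof (induction rule: borel_measurable_induct)
  case (cong Z Z')
  have "space G = space M" using sub by (auto simp: subalgebra_def)
  then have "(\<integral>\<^sup>+\<omega>. Z \<omega> * \<phi> \<omega> \<partial>M) = (\<integral>\<^sup>+\<omega>. Z' \<omega> * \<phi> \<omega> \<partial>M)" for \<phi>
    using cong(3) by (intro nn_integral_cong) auto
  with cong(4) show ?case by simp
next
  case (set A)
  then show ?case by (rule cond_jensen_set)
next
  case (mult u c)
  note [measurable] = measurable_from_subalg[OF sub mult(2)]
    strongly_measurable_norm[OF g_measurable(2)] perturbation_measurable[OF g_measurable(2)]
  show ?case
    using mult(4) by (simp add: mult.assoc nn_integral_cmult mult_left_mono)
next
  case (add u v)
  note [measurable] = measurable_from_subalg[OF sub add.hyps(1)] measurable_from_subalg[OF sub add.hyps(3)]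
    strongly_measurable_norm[OF g_measurable(2)] perturbation_measurable[OF g_measurable(2)]
  show ?case
    using add.IH by (simp add: distrib_right nn_integral_add add_mono)
next
  case (seq U)
  note [measurable] = measurable_from_subalg[OF sub seq(1)]
    strongly_measurable_norm[OF g_measurable(2)] perturbation_measurable[OF g_measurable(2)]
  have *: "(\<integral>\<^sup>+\<omega>. (SUP i. U i) \<omega> * \<phi> \<omega> \<partial>M) = (SUP i. \<integral>\<^sup>+\<omega>. U i \<omega> * \<phi> \<omega> \<partial>M)"
    if [measurable]: "\<phi> \<in> borel_measurable M" for \<phi> :: "'w \<Rightarrow> ennreal"
  proof -
    have "incseq (\<lambda>i \<omega>. U i \<omega> * \<phi> \<omega>)"
      using seq.hyps(3) by (auto simp: incseq_def le_fun_def intro: mult_right_mono)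
    then have "(SUP i. \<integral>\<^sup>+\<omega>. U i \<omega> * \<phi> \<omega> \<partial>M) = (\<integral>\<^sup>+\<omega>. (SUP i. U i \<omega> * \<phi> \<omega>) \<partial>M)"
      by (intro nn_integral_monotone_convergence_SUP[symmetric]) auto
    then show ?thesis
      by (simp add: image_comp SUP_mult_right_ennreal)
  qed
  have "(SUP i. \<integral>\<^sup>+\<omega>. U i \<omega> * ennreal (norm (g \<omega>)) \<partial>M)
      \<le> (SUP i. \<integral>\<^sup>+\<omega>. U i \<omega> * ennreal (norm (g \<omega> + t *\<^sub>R (f \<omega> - g \<omega>))) \<partial>M)"
    using seq.IH by (intro SUP_mono) blast
  then show ?case
    by (subst (1 2) *) auto
qed

end

text \<open>
  The argument uses the derivative of the norm rather than that of its power \<open>q\<close>: the difference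
  quotients of the norm in direction \<open>h\<close> are bounded by \<open>|h|\<close>, which dominates the limit.
\<close>

lemma expectation_directional_deriv_norm_nonneg:
  fixes f g :: "'w \<Rightarrow> 'x::real_normed_vector" and Z :: "'w \<Rightarrow> real"
  assumes fin: "finite_measure M" and sub: "subalgebra M G"
    and f: "strongly_measurable M f" and ce: "is_cond_expectation M G f g"
    and Z: "Z \<in> borel_measurable G" and Z0: "\<And>\<omega>. \<omega> \<in> space M \<Longrightarrow> 0 \<le> Z \<omega>"
    and int_g: "integrable M (\<lambda>\<omega>. Z \<omega> * norm (g \<omega>))"
    and int_d: "integrable M (\<lambda>\<omega>. Z \<omega> * norm (f \<omega> - g \<omega>))"
  shows "integrable M (\<lambda>\<omega>. Z \<omega> * directional_deriv norm (g \<omega>) (f \<omega> - g \<omega>))" (is "integrable M ?D")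
    and "0 \<le> (\<integral>\<omega>. Z \<omega> * directional_deriv norm (g \<omega>) (f \<omega> - g \<omega>) \<partial>M)"
proof -
  have g: "strongly_measurable M g"
    using ce sub strongly_measurable_subalgebra unfolding is_cond_expectation_def by blast
  define n where "n t \<omega> = norm (g \<omega> + t *\<^sub>R (f \<omega> - g \<omega>))" for t \<omega>
  have n_meas [measurable]: "n t \<in> borel_measurable M" for t
    using strongly_measurable_norm[OF strongly_measurable_lincomb[OF g strongly_measurable_diff[OF f g], of 1 t]]
    by (simp add: n_def[abs_def])
  note [measurable] = measurable_from_subalg[OF sub Z] strongly_measurable_norm[OF g]
    strongly_measurable_norm[OF strongly_measurable_diff[OF f g]]
  \<comment> \<open>Weighted difference quotients of the norm along the step sizes
    \<open>1 / (i + 1)\<close>.\<close>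
  define u where "u i \<omega> = Z \<omega> * ((n (1 / real (Suc i)) \<omega> - norm (g \<omega>)) / (1 / real (Suc i)))" for i \<omega>
  have u_meas: "u i \<in> borel_measurable M" for i
    unfolding u_def by measurable
  have t: "filterlim (\<lambda>i. 1 / real (Suc i)) (at_right 0) sequentially"
    using LIMSEQ_Suc[OF lim_1_over_n] by (auto simp: filterlim_at)
  have lim: "(\<lambda>i. u i \<omega>) \<longlonglongrightarrow> ?D \<omega>" for \<omega>
    unfolding u_def n_def
    by (intro tendsto_mult_left filterlim_compose[OF tendsto_directional_deriv_norm t])
  have bound: "norm (u i \<omega>) \<le> Z \<omega> * norm (f \<omega> - g \<omega>)" if "\<omega> \<in> space M" for i \<omega>
    unfolding u_def n_def real_norm_def abs_mult using Z0[OF that]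
    by (simp only: abs_of_nonneg) (intro mult_left_mono norm_quotient_bound, auto)
  have D_meas: "?D \<in> borel_measurable M"
    using u_meas lim by (rule borel_measurable_LIMSEQ_real[rotated])
  show "integrable M ?D"
    using D_meas u_meas int_d
    by (rule integrable_dominated_convergence) (auto intro!: AE_I2 lim bound simp del: real_norm_def)
  have "(\<lambda>i. \<integral>\<omega>. u i \<omega> \<partial>M) \<longlonglongrightarrow> (\<integral>\<omega>. ?D \<omega> \<partial>M)"
    using D_meas u_meas int_d
    by (rule integral_dominated_convergence) (auto intro!: AE_I2 lim bound simp del: real_norm_def)
  \<comment> \<open>Up to the factor \<open>1 / t\<close>, this integral is the difference of the
    two sides of Jensen's inequality, which is finite by the integrability hypotheses.\<close>
  moreover have "0 \<le> (\<integral>\<omega>. u i \<omega> \<partial>M)" for i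
  proof -
    define t where "t = 1 / real (Suc i)"
    have "0 < t" by (simp add: t_def)
    have le: "n t \<omega> \<le> norm (g \<omega>) + t * norm (f \<omega> - g \<omega>)" for \<omega>
      using norm_triangle_ineq[of "g \<omega>" "t *\<^sub>R (f \<omega> - g \<omega>)"] \<open>0 < t\<close> by (simp add: n_def)
    have int_n: "integrable M (\<lambda>\<omega>. Z \<omega> * n t \<omega>)"
    proof (rule Bochner_Integration.integrable_bound)
      show "integrable M (\<lambda>\<omega>. Z \<omega> * norm (g \<omega>) + t * (Z \<omega> * norm (f \<omega> - g \<omega>)))"
        using int_g int_d by auto
      show "AE \<omega> in M. norm (Z \<omega> * n t \<omega>) \<le> norm (Z \<omega> * norm (g \<omega>) + t * (Z \<omega> * norm (f \<omega> - g \<omega>)))"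
      proof (rule AE_I2)
        fix \<omega> assume "\<omega> \<in> space M"
        then have "Z \<omega> * n t \<omega> \<le> Z \<omega> * (norm (g \<omega>) + t * norm (f \<omega> - g \<omega>))" "0 \<le> Z \<omega> * n t \<omega>"
          using Z0 le by (auto intro!: mult_left_mono simp: n_def)
        then show "norm (Z \<omega> * n t \<omega>) \<le> norm (Z \<omega> * norm (g \<omega>) + t * (Z \<omega> * norm (f \<omega> - g \<omega>)))"
          by (simp add: algebra_simps)
      qed
    qed measurable
    have nn: "ennreal (\<integral>\<omega>. Z \<omega> * y \<omega> \<partial>M) = (\<integral>\<^sup>+\<omega>. ennreal (Z \<omega>) * ennreal (y \<omega>) \<partial>M)"
      if "integrable M (\<lambda>\<omega>. Z \<omega> * y \<omega>)" "\<And>\<omega>. 0 \<le> y \<omega>" for y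
    proof -
      have "(\<integral>\<^sup>+\<omega>. ennreal (Z \<omega>) * ennreal (y \<omega>) \<partial>M) = (\<integral>\<^sup>+\<omega>. ennreal (Z \<omega> * y \<omega>) \<partial>M)"
        using Z0 that(2) by (intro nn_integral_cong) (simp add: ennreal_mult)
      also have "\<dots> = ennreal (\<integral>\<omega>. Z \<omega> * y \<omega> \<partial>M)"
        using Z0 that by (intro nn_integral_eq_integral) auto
      finally show ?thesis by simp
    qed
    have "ennreal (\<integral>\<omega>. Z \<omega> * norm (g \<omega>) \<partial>M) \<le> ennreal (\<integral>\<omega>. Z \<omega> * n t \<omega> \<partial>M)"
      using cond_jensen_norm[OF fin sub f ce, of "\<lambda>\<omega>. ennreal (Z \<omega>)" t, folded n_def] Z
        nn[OF int_g] nn[OF int_n] by (simp add: n_def)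
    moreover have "0 \<le> (\<integral>\<omega>. Z \<omega> * n t \<omega> \<partial>M)"
      using Z0 by (intro Bochner_Integration.integral_nonneg_AE AE_I2) (simp add: n_def)
    ultimately have "(\<integral>\<omega>. Z \<omega> * norm (g \<omega>) \<partial>M) \<le> (\<integral>\<omega>. Z \<omega> * n t \<omega> \<partial>M)"
      by simp
    moreover have "u i \<omega> = (Z \<omega> * n t \<omega> - Z \<omega> * norm (g \<omega>)) / t" for \<omega>
      by (simp add: u_def t_def algebra_simps)
    ultimately show ?thesis
      using \<open>0 < t\<close> int_n int_g by simp
  qed
  ultimately show "0 \<le> (\<integral>\<omega>. ?D \<omega> \<partial>M)"
    by (auto intro: LIMSEQ_le_const)
qed

section \<open>The weighted inequality\<close>

lemma running_max_0: "running_max f 0 \<omega> = norm (f 0 \<omega>)"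
  by (simp add: running_max_def)

lemma running_max_Suc: "running_max f (Suc n) \<omega> = max (running_max f n \<omega>) (norm (f (Suc n) \<omega>))"
  by (simp add: running_max_def atMost_Suc max.commute)

lemma norm_le_running_max: "norm (f n \<omega>) \<le> running_max f n \<omega>"
  by (simp add: running_max_def)

lemma running_max_nonneg: "0 \<le> running_max f n \<omega>"
  by (rule order_trans[OF norm_ge_zero norm_le_running_max])

lemma running_max_in: "\<exists>k\<le>n. running_max f n \<omega> = norm (f k \<omega>)"
proof -
  have "running_max f n \<omega> \<in> (\<lambda>k. norm (f k \<omega>)) ` {..n}"
    unfolding running_max_def by (rule Max_in) auto
  then show ?thesis by auto
qed

lemma running_max_measurable:
  assumes "\<And>k. k \<le> n \<Longrightarrow> (\<lambda>\<omega>. norm (f k \<omega>)) \<in> borel_measurable N"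
  shows "running_max f n \<in> borel_measurable N"
  using assms
proof (induction n)
  case 0
  then show ?case by (simp add: running_max_0[abs_def])
next
  case (Suc n)
  then show ?case by (simp add: running_max_Suc[abs_def])
qed

text \<open>\<open>C\<close> is kept as a parameter because the constants of the theorem arise from
  different choices: \<open>C'\<close> asks for the larger one unless the running maximum of the
  weights never jumps.\<close>

lemma weighted_davis_inequality:
  fixes q \<delta> C :: real
    and M :: "'w measure"
    and F :: "nat \<Rightarrow> 'w measure"
    and f :: "nat \<Rightarrow> 'w \<Rightarrow> 'x::banach"
    and w :: "nat \<Rightarrow> 'w \<Rightarrow> real"
  assumes q: "2 \<le> q"
    and \<delta>: "0 < \<delta>"
    and convexity: "\<And>x h :: 'x. norm (x + h) powr q \<ge>
          norm x powr q + directional_deriv (\<lambda>y. norm y powr q) x h + \<delta> * norm h powr q"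
    and space: "filtered_prob_space M F"
    and martingale: "banach_martingale M F f"
    and weights: "adapted_weights M F w"
    and C: "2 * q - 2 \<le> C"
    and C': "2 * q - 1 \<le> C \<or>
          (\<forall>n. \<forall>\<omega>\<in>space M. running_max w (Suc n) \<omega> = running_max w n \<omega>)"
  shows "weighted_inequality M f w q \<delta> (1 + C)"
proof -
  interpret prob_space M
    using space by (simp add: filtered_prob_space_def)
  have sub: "subalgebra M (F n)" for n
    using space by (simp add: filtered_prob_space_def)
  have filt: "subalgebra (F n) (F k)" if "k \<le> n" for k n
    using space that unfolding filtered_prob_space_def filtration_def subalgebra_def by auto
  have ce: "is_cond_expectation M (F n) (f (Suc n)) (f n)" for n
    using martingale by (simp add: banach_martingale_def)
  have fF: "strongly_measurable (F n) (f n)" for n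
    using ce by (simp add: is_cond_expectation_def)
  have fM: "strongly_measurable M (f n)" for n
    using strongly_measurable_subalgebra[OF sub fF] .
  have wF: "w n \<in> borel_measurable (F n)" and w_pos: "\<omega> \<in> space M \<Longrightarrow> 0 < w n \<omega>" for n \<omega>
    using weights by (auto simp: adapted_weights_def)
  have C0: "0 \<le> C" using q C by simp

  \<comment> \<open>The Bellman function, its ingredients and their measurability\<close>
  define s W where "s = running_max f" and "W = running_max w"
  define V where "V n \<omega> = W n \<omega> * (norm (f n \<omega>) powr q / s n \<omega> powr (q - 1) + C * s n \<omega>)" for n \<omega>
  define Z where "Z n \<omega> = W n \<omega> * (q * norm (f n \<omega>) powr (q - 1) / s n \<omega> powr (q - 1))" for n \<omega>
  define D where "D n \<omega> = directional_deriv norm (f n \<omega>) (f (Suc n) \<omega> - f n \<omega>)" for n \<omega>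
  define T where "T n \<omega> = norm (f (Suc n) \<omega> - f n \<omega>) powr q / s (Suc n) \<omega> powr (q - 1) * w (Suc n) \<omega>" for n \<omega>
  define I where "I = (\<integral>\<^sup>+\<omega>. (SUP n. ennreal (norm (f n \<omega>))) * (SUP n. ennreal (w n \<omega>)) \<partial>M)"

  have s0: "0 \<le> s n \<omega>" and W0: "0 \<le> W n \<omega>" and fs: "norm (f n \<omega>) \<le> s n \<omega>" and wW: "w n \<omega> \<le> W n \<omega>"
    and sS: "s (Suc n) \<omega> = max (s n \<omega>) (norm (f (Suc n) \<omega>))" and WS: "W n \<omega> \<le> W (Suc n) \<omega>" for n \<omega>
    using norm_le_running_max[of w n \<omega>]
    by (auto simp: s_def W_def running_max_nonneg norm_le_running_max running_max_Suc)
  have sF [measurable]: "s n \<in> borel_measurable (F n)" for n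
    unfolding s_def
    by (rule running_max_measurable[OF measurable_from_subalg[OF filt strongly_measurable_norm[OF fF]]])
  \<comment> \<open>\<open>running_max\<close> takes norms; for positive weights these are the
    weights themselves.\<close>
  have norm_wF: "(\<lambda>\<omega>. norm (w n \<omega>)) \<in> borel_measurable (F n)" for n
    using wF[of n] by measurable
  have WF [measurable]: "W n \<in> borel_measurable (F n)" for n
    unfolding W_def
    by (rule running_max_measurable[OF measurable_from_subalg[OF filt norm_wF]])
  note [measurable] = strongly_measurable_norm[OF fF]
  have ZF: "Z n \<in> borel_measurable (F n)" for n
    unfolding Z_def by measurable
  note [measurable] = measurable_from_subalg[OF sub sF] measurable_from_subalg[OF sub WF]
    measurable_from_subalg[OF sub wF] measurable_from_subalg[OF sub ZF]
    strongly_measurable_norm[OF fM] strongly_measurable_norm[OF strongly_measurable_diff[OF fM fM]]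
  have V_meas [measurable]: "V n \<in> borel_measurable M" for n
    unfolding V_def by measurable
  have T_meas [measurable]: "T n \<in> borel_measurable M" for n
    unfolding T_def by measurable

  \<comment> \<open>Pointwise bounds\<close>
  have powr_s: "norm (f n \<omega>) powr q / s n \<omega> powr (q - 1) \<le> s n \<omega>" for n \<omega>
  proof (cases "s n \<omega> = 0")
    case False
    then have "s n \<omega> powr q = s n \<omega> * s n \<omega> powr (q - 1)"
      using s0[of n \<omega>] by (simp add: powr_diff)
    moreover have "norm (f n \<omega>) powr q \<le> s n \<omega> powr q"
      using fs q by (intro powr_mono2) auto
    ultimately show ?thesis
      using False by (simp add: divide_le_eq)
  qed simp
  have V0: "0 \<le> V n \<omega>" for n \<omega>
    using W0 C0 s0 by (simp add: V_def)
  have V_le: "V n \<omega> \<le> (1 + C) * (W n \<omega> * s n \<omega>)" for n \<omega>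
  proof -
    have "V n \<omega> \<le> W n \<omega> * (s n \<omega> + C * s n \<omega>)"
      unfolding V_def by (intro mult_left_mono add_right_mono powr_s W0)
    then show ?thesis by (simp add: algebra_simps)
  qed
  have Z0: "0 \<le> Z n \<omega>" for n \<omega>
    using W0 q by (simp add: Z_def)
  have Z_le: "Z n \<omega> \<le> q * W n \<omega>" for n \<omega>
  proof -
    have "norm (f n \<omega>) powr (q - 1) \<le> s n \<omega> powr (q - 1)"
      using fs q by (intro powr_mono2) auto
    then have "norm (f n \<omega>) powr (q - 1) / s n \<omega> powr (q - 1) \<le> 1"
      by (simp add: divide_le_eq_1)
    from mult_left_mono[OF this, of "q * W n \<omega>"] show ?thesis
      using q W0 by (simp add: Z_def mult.assoc mult.left_commute)
  qed
  have T0: "0 \<le> T n \<omega>" if "\<omega> \<in> space M" for n \<omega>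
    using w_pos[OF that, of "Suc n"] by (simp add: T_def)

  \<comment> \<open>The convexity hypothesis at \<open>f n \<omega>\<close> in the direction of the
    increment, rewritten with the derivative of the norm, becomes the assumption \<open>conv\<close>
    of \<open>bellman_step\<close>.\<close>
  have step: "V n \<omega> + Z n \<omega> * D n \<omega> + \<delta> * T n \<omega> \<le> V (Suc n) \<omega>" if \<omega>: "\<omega> \<in> space M" for n \<omega>
  proof -
    let ?h = "f (Suc n) \<omega> - f n \<omega>"
    have "norm (f n \<omega>) powr q + q * norm (f n \<omega>) powr (q - 1) * D n \<omega> + \<delta> * norm ?h powr q
        \<le> norm (f (Suc n) \<omega>) powr q"
      using convexity[of "f n \<omega>" ?h] q by (simp add: D_def directional_deriv_norm_powr)
    moreover have "- norm ?h \<le> D n \<omega>" "D n \<omega> \<le> norm (f (Suc n) \<omega>) - norm (f n \<omega>)"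
      using directional_deriv_norm_bounds[of "f n \<omega>" ?h] by (auto simp: D_def abs_le_iff)
    moreover have "norm ?h \<le> norm (f n \<omega>) + norm (f (Suc n) \<omega>)"
      using norm_triangle_ineq4[of "f (Suc n) \<omega>" "f n \<omega>"] by simp
    moreover have "W (Suc n) \<omega> = W n \<omega> \<or> 2 * q - 1 \<le> C"
      using C' \<omega> by (auto simp: W_def)
    ultimately show ?thesis
      unfolding V_def Z_def T_def sS using q \<delta> fs W0 WS wW C
      by (intro bellman_step) auto
  qed

  show ?thesis
  \<comment> \<open>An infinite right-hand side makes the claim trivial; a finite one provides all
    the integrability needed below.\<close>
  proof (cases "I = \<infinity>")
    case True
    then have "ennreal (1 + C) * I = \<infinity>"
      using C0 by (simp add: ennreal_mult_eq_top_iff)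
    then show ?thesis
      unfolding weighted_inequality_def I_def by simp
  next
    case False

    \<comment> \<open>Integrability\<close>
    have Ws_I: "(\<integral>\<^sup>+\<omega>. ennreal (W n \<omega> * s n \<omega>) \<partial>M) \<le> I" for n
      unfolding I_def
    proof (rule nn_integral_mono)
      fix \<omega> assume \<omega>: "\<omega> \<in> space M"
      \<comment> \<open>The two maxima may be attained at different times, which the product of the
        two suprema allows.\<close>
      obtain k where "W n \<omega> = w k \<omega>"
        using running_max_in[of n w \<omega>] w_pos[OF \<omega>] unfolding W_def
        by (metis real_norm_def abs_of_pos)
      moreover obtain l where "s n \<omega> = norm (f l \<omega>)"
        using running_max_in[of n f \<omega>] by (auto simp: s_def)
      ultimately have "ennreal (s n \<omega>) * ennreal (W n \<omega>)
          \<le> (SUP n. ennreal (norm (f n \<omega>))) * (SUP n. ennreal (w n \<omega>))"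
        by (auto intro!: mult_mono SUP_upper)
      then show "ennreal (W n \<omega> * s n \<omega>) \<le> (SUP n. ennreal (norm (f n \<omega>))) * (SUP n. ennreal (w n \<omega>))"
        using W0 s0 by (simp add: ennreal_mult mult.commute)
    qed
    have int_Ws: "integrable M (\<lambda>\<omega>. W n \<omega> * s n \<omega>)" for n
    proof (rule integrableI_nonneg)
      show "(\<integral>\<^sup>+\<omega>. ennreal (W n \<omega> * s n \<omega>) \<partial>M) < \<infinity>"
        using Ws_I[of n] False by (simp add: top.not_eq_extremum order.strict_trans1)
    qed (auto simp: W0 s0)
    have int_V: "integrable M (V n)" for n
      by (rule Bochner_Integration.integrable_bound[of M "\<lambda>\<omega>. (1 + C) * (W n \<omega> * s n \<omega>)"])
         (use int_Ws V0 V_le W0 s0 C0 in auto)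
    \<comment> \<open>The factor \<open>2\<close> leaves room for the increment, whose norm is at
      most twice the maximum at time \<open>Suc n\<close>.\<close>
    have Zs: "Z n \<omega> * x \<le> 2 * q * (W (Suc n) \<omega> * s (Suc n) \<omega>)" if "x \<le> 2 * s (Suc n) \<omega>" for x n \<omega>
    proof -
      have "Z n \<omega> * x \<le> Z n \<omega> * (2 * s (Suc n) \<omega>)"
        using that Z0 by (rule mult_left_mono)
      also have "\<dots> \<le> (q * W (Suc n) \<omega>) * (2 * s (Suc n) \<omega>)"
        using Z_le[of n \<omega>] mult_left_mono[OF WS[of n \<omega>], of q] q s0
        by (intro mult_right_mono) (auto intro: order_trans)
      finally show ?thesis by (simp add: mult_ac)
    qed
    have fs': "norm (f n \<omega>) \<le> s (Suc n) \<omega>" "norm (f (Suc n) \<omega>) \<le> s (Suc n) \<omega>" for n \<omega>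
      using fs[of n \<omega>] by (auto simp: sS)
    have int_bound: "integrable M (\<lambda>\<omega>. Z n \<omega> * x \<omega>)"
      if "x \<in> borel_measurable M" "\<And>\<omega>. 0 \<le> x \<omega>" "\<And>\<omega>. x \<omega> \<le> 2 * s (Suc n) \<omega>" for x n
      by (rule Bochner_Integration.integrable_bound[of M "\<lambda>\<omega>. 2 * q * (W (Suc n) \<omega> * s (Suc n) \<omega>)"])
         (use int_Ws that Z0 Zs W0 s0 q in \<open>auto simp: abs_mult\<close>)
    have int_g: "integrable M (\<lambda>\<omega>. Z n \<omega> * norm (f n \<omega>))" for n
    proof (intro int_bound)
      show "norm (f n \<omega>) \<le> 2 * s (Suc n) \<omega>" for \<omega>
        using fs'(1)[of n \<omega>] s0[of "Suc n" \<omega>] by linarith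
    qed auto
    have int_d: "integrable M (\<lambda>\<omega>. Z n \<omega> * norm (f (Suc n) \<omega> - f n \<omega>))" for n
    proof (intro int_bound)
      show "norm (f (Suc n) \<omega> - f n \<omega>) \<le> 2 * s (Suc n) \<omega>" for \<omega>
        using norm_triangle_ineq4[of "f (Suc n) \<omega>" "f n \<omega>"] fs'[of n \<omega>] by linarith
    qed auto
    note deriv = expectation_directional_deriv_norm_nonneg[OF finite_measure_axioms sub fM ce ZF Z0 int_g int_d,
        folded D_def]
    \<comment> \<open>The inequality \<open>step\<close> itself dominates the square function term
      by a combination of integrable functions.\<close>
    have int_T: "integrable M (\<lambda>\<omega>. \<delta> * T n \<omega>)" for n
    proof (rule Bochner_Integration.integrable_bound)
      show "integrable M (\<lambda>\<omega>. V (Suc n) \<omega> - V n \<omega> - Z n \<omega> * D n \<omega>)"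
        using int_V deriv by auto
      show "AE \<omega> in M. norm (\<delta> * T n \<omega>) \<le> norm (V (Suc n) \<omega> - V n \<omega> - Z n \<omega> * D n \<omega>)"
      proof (rule AE_I2)
        fix \<omega> assume \<omega>: "\<omega> \<in> space M"
        then have "0 \<le> \<delta> * T n \<omega>" using T0 \<delta> by simp
        then show "norm (\<delta> * T n \<omega>) \<le> norm (V (Suc n) \<omega> - V n \<omega> - Z n \<omega> * D n \<omega>)"
          using step[OF \<omega>, of n] by simp
      qed
    qed measurable

    \<comment> \<open>Telescoping of expectations\<close>
    have decr: "(\<integral>\<omega>. V n \<omega> \<partial>M) + (\<integral>\<omega>. \<delta> * T n \<omega> \<partial>M) \<le> (\<integral>\<omega>. V (Suc n) \<omega> \<partial>M)" for n
    proof -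
      have "(\<integral>\<omega>. V n \<omega> \<partial>M) + (\<integral>\<omega>. Z n \<omega> * D n \<omega> \<partial>M) + (\<integral>\<omega>. \<delta> * T n \<omega> \<partial>M)
          = (\<integral>\<omega>. V n \<omega> + Z n \<omega> * D n \<omega> + \<delta> * T n \<omega> \<partial>M)"
        using int_V deriv(1) int_T by (simp add: Bochner_Integration.integral_add)
      also have "\<dots> \<le> (\<integral>\<omega>. V (Suc n) \<omega> \<partial>M)"
        using int_V deriv(1) int_T step by (intro integral_mono) auto
      finally show ?thesis using deriv(2)[of n] by linarith
    qed
    have sum: "(\<integral>\<omega>. V 0 \<omega> \<partial>M) + (\<Sum>n<N. \<integral>\<omega>. \<delta> * T n \<omega> \<partial>M) \<le> (\<integral>\<omega>. V N \<omega> \<partial>M)" for N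
    proof (induction N)
      case (Suc N)
      then show ?case using decr[of N] by simp
    qed simp
    have nn_V: "ennreal (\<integral>\<omega>. V n \<omega> \<partial>M) = (\<integral>\<^sup>+\<omega>. ennreal (V n \<omega>) \<partial>M)" for n
      using int_V V0 by (intro nn_integral_eq_integral[symmetric]) auto
    have nn_T: "ennreal (\<integral>\<omega>. \<delta> * T n \<omega> \<partial>M) = (\<integral>\<^sup>+\<omega>. ennreal (\<delta> * T n \<omega>) \<partial>M)" for n
      using int_T T0 \<delta> by (intro nn_integral_eq_integral[symmetric]) auto
    have int_T0: "0 \<le> (\<integral>\<omega>. \<delta> * T n \<omega> \<partial>M)" for n
      using T0 \<delta> by (intro Bochner_Integration.integral_nonneg_AE AE_I2) auto
    have int_V0: "0 \<le> (\<integral>\<omega>. V n \<omega> \<partial>M)" for n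
      using V0 by simp
    have partial: "(\<integral>\<^sup>+\<omega>. ennreal (V 0 \<omega>) \<partial>M) + (\<Sum>n<N. \<integral>\<^sup>+\<omega>. ennreal (\<delta> * T n \<omega>) \<partial>M) \<le> ennreal (1 + C) * I" for N
    proof -
      have "(\<integral>\<^sup>+\<omega>. ennreal (V 0 \<omega>) \<partial>M) + (\<Sum>n<N. \<integral>\<^sup>+\<omega>. ennreal (\<delta> * T n \<omega>) \<partial>M)
          = ennreal ((\<integral>\<omega>. V 0 \<omega> \<partial>M) + (\<Sum>n<N. \<integral>\<omega>. \<delta> * T n \<omega> \<partial>M))"
        unfolding nn_V[symmetric] nn_T[symmetric]
        using int_V0 int_T0 by (simp add: sum_nonneg sum_ennreal)
      also have "\<dots> \<le> ennreal (\<integral>\<omega>. V N \<omega> \<partial>M)"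
        by (rule ennreal_leI[OF sum])
      also have "\<dots> \<le> (\<integral>\<^sup>+\<omega>. ennreal (1 + C) * ennreal (W N \<omega> * s N \<omega>) \<partial>M)"
        unfolding nn_V using V_le W0 s0 C0
        by (intro nn_integral_mono) (simp add: ennreal_leI del: ennreal_plus flip: ennreal_mult'')
      also have "\<dots> \<le> ennreal (1 + C) * I"
        using Ws_I[of N] by (simp add: nn_integral_cmult mult_left_mono)
      finally show ?thesis .
    qed

    \<comment> \<open>Passage from partial sums to the series\<close>
    have "(\<integral>\<^sup>+\<omega>. ennreal ((1 + C) * norm (f 0 \<omega>) * w 0 \<omega>) + ennreal \<delta> * (\<Sum>n. ennreal (T n \<omega>)) \<partial>M)
        = (\<integral>\<^sup>+\<omega>. ennreal (V 0 \<omega>) + (\<Sum>n. ennreal (\<delta> * T n \<omega>)) \<partial>M)"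
    proof (rule nn_integral_cong)
      fix \<omega> assume \<omega>: "\<omega> \<in> space M"
      have "W 0 \<omega> = w 0 \<omega>"
        using w_pos[OF \<omega>, of 0] by (simp add: W_def running_max_0)
      \<comment> \<open>At time \<open>0\<close> the maxima are the values themselves, so
        \<open>V 0\<close> equals its upper bound and yields the initial term exactly; if
        \<open>f 0 \<omega> = 0\<close>, the quotient is \<open>0 / 0 = 0\<close>.\<close>
      moreover have "norm (f 0 \<omega>) powr q / norm (f 0 \<omega>) powr (q - 1) = norm (f 0 \<omega>)"
        by (cases "f 0 \<omega> = 0") (auto simp: powr_diff)
      ultimately have "(1 + C) * norm (f 0 \<omega>) * w 0 \<omega> = V 0 \<omega>"
        by (simp add: V_def s_def running_max_0 algebra_simps)
      moreover have "ennreal \<delta> * (\<Sum>n. ennreal (T n \<omega>)) = (\<Sum>n. ennreal (\<delta> * T n \<omega>))"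
        using \<delta> T0[OF \<omega>] by (simp add: ennreal_mult flip: ennreal_suminf_cmult)
      ultimately show "ennreal ((1 + C) * norm (f 0 \<omega>) * w 0 \<omega>) + ennreal \<delta> * (\<Sum>n. ennreal (T n \<omega>))
          = ennreal (V 0 \<omega>) + (\<Sum>n. ennreal (\<delta> * T n \<omega>))"
        by simp
    qed
    also have "\<dots> = (\<integral>\<^sup>+\<omega>. ennreal (V 0 \<omega>) \<partial>M) + (\<Sum>n. \<integral>\<^sup>+\<omega>. ennreal (\<delta> * T n \<omega>) \<partial>M)"
      by (simp add: nn_integral_add nn_integral_suminf)
    also have "\<dots> \<le> ennreal (1 + C) * I"
    proof (rule LIMSEQ_le_const2)
      show "(\<lambda>N. (\<integral>\<^sup>+\<omega>. ennreal (V 0 \<omega>) \<partial>M) + (\<Sum>n<N. \<integral>\<^sup>+\<omega>. ennreal (\<delta> * T n \<omega>) \<partial>M))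
          \<longlonglongrightarrow> (\<integral>\<^sup>+\<omega>. ennreal (V 0 \<omega>) \<partial>M) + (\<Sum>n. \<integral>\<^sup>+\<omega>. ennreal (\<delta> * T n \<omega>) \<partial>M)"
        by (intro tendsto_add tendsto_const summable_LIMSEQ summableI)
    qed (use partial in blast)
    finally show ?thesis
      unfolding weighted_inequality_def I_def T_def s_def .
  qed
qed

theorem theorem2p3:
  fixes q \<delta> :: real
    and M :: "'w measure"
    and F :: "nat \<Rightarrow> 'w measure"
    and f :: "nat \<Rightarrow> 'w \<Rightarrow> 'x::banach"
    and w :: "nat \<Rightarrow> 'w \<Rightarrow> real"
  assumes q: "2 \<le> q"
    and \<delta>: "0 < \<delta>"
    and convexity: "\<And>x h :: 'x. norm (x + h) powr q \<ge>
          norm x powr q + directional_deriv (\<lambda>y. norm y powr q) x h + \<delta> * norm h powr q"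
    and space: "filtered_prob_space M F"
    and martingale: "banach_martingale M F f"
    and weights: "adapted_weights M F w"
  shows "0 < gamma_of q \<and> weighted_inequality M f w q \<delta> (gamma_of q) \<and>
    (q = 2 \<longrightarrow> weighted_inequality M f w q \<delta> 4) \<and>
    (q = 2 \<and> \<delta> = 1 \<and> (\<forall>n. \<forall>\<omega>\<in>space M. w n \<omega> = 1) \<longrightarrow> weighted_inequality M f w q \<delta> 3)"
proof -
  note davis = weighted_davis_inequality[OF assms]
  \<comment> \<open>The choice \<open>C = 2 * q - 1\<close> pays for jumps of both maxima and gives
    \<open>1 + C = 2 * q\<close>.\<close>
  have general: "weighted_inequality M f w q \<delta> (gamma_of q)"
    using davis[of "2 * q - 1"] by (simp add: gamma_of_def)
  \<comment> \<open>Constant weights have a constant running maximum, so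
    \<open>C = 2 * q - 2\<close> is enough; for \<open>q = 2\<close> this is
    \<open>C = 2\<close>.\<close>
  have unweighted: "weighted_inequality M f w q \<delta> 3" if "q = 2" "\<forall>n. \<forall>\<omega>\<in>space M. w n \<omega> = 1"
  proof -
    have "running_max w n \<omega> = 1" if "\<omega> \<in> space M" for n \<omega>
      using running_max_in[of n w \<omega>] that \<open>\<forall>n. \<forall>\<omega>\<in>space M. w n \<omega> = 1\<close> by auto
    then show ?thesis
      using davis[of 2] \<open>q = 2\<close> by simp
  qed
  show ?thesis
    using general unweighted q by (auto simp: gamma_of_def)
qed

end
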